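(* The problem $$V_{\rm P}:=\max_{X\in\mathcal{Q}}\{\langle\tilde A,X\rangle:\ \operatorname{rank}(X)\le k,\ f(\lambda(X))\le0\}$$ has an optimal solution $X^*$, specified as follows. (i) Given $\mathcal{Q}=\mathcal{S}_+^n$, suppose that $\tilde A=U\operatorname{Diag}(\beta)U^\top$ is the eigendecomposition of $\tilde A$ with eigenvalues $\beta_1\ge\cdots\ge\beta_n$. Then $X^*=U\operatorname{Diag}(\lambda^* )U^\top$, where $$\lambda^*\in\arg\max_{\lambda\in\mathbb{R}_+^n}\{\lambda^\top\beta:\ \lambda_i=0\ \forall i\in[k+1,n],\ f(\lambda)\le0\}.$$ (ii) Given $\mathcal{Q}=\mathbb{R}^{n\times p}$, suppose that $\tilde A=U\operatorname{Diag}(\beta)V^\top$ is the singular value decomposition of $\tilde A$ with singular values $\beta_1\ge\cdots\ge\beta_n$. Then $X^*=U\operatorname{Diag}(\lambda^* )V^\top$, where $$\lambda^*\in\arg\max_{\lambda\in\mathbb{R}_+^n}\{\lambda^\top\beta:\ \lambda_i=0\ \forall i\in[k+1,n],\ f(\lambda)\le0\}.$$ (iii) Given $\mathcal{Q}=\mathcal{S}^n$, suppose that $\tilde A=U\operatorname{Diag}(\beta)U^\top$ is the eigendecomposition of $\tilde A$ with eigenvalues $\beta_1\ge\cdots\ge\beta_n$. Then $X^*=U\operatorname{Diag}(\lambda^* )U^\top$, where $\lambda^*\in\mathbb{R}^n$ is a maximizer $\lambda$ in $$\max_{s\in[k+1]}\ \max_{\lambda\in\mathbb{R}^n}\{\lambda^\top\beta:\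 \lambda_1\ge\cdots\ge\lambda_n,\ \lambda_s=\lambda_{s+n-k-1}=0,\ f(\lambda)\le0\}.$$ (iv) Given $\mathcal{Q}=\mathcal{S}^n$ and a sign-invariant function $f$, suppose that $\tilde A=U\operatorname{Diag}(\beta)U^\top$ is the eigendecomposition of $\tilde A$ with eigenvalues satisfying $|\beta_1|\ge\cdots\ge|\beta_n|$. Then $X^*=U\operatorname{Diag}(\lambda^* )U^\top$, where $$\lambda^*\in\arg\max_{\lambda\in\mathbb{R}^n}\{|\lambda|^\top|\beta|:\ |\lambda_i|=0\ \forall i\in[k+1,n],\ f(|\lambda|)\le0\}.$$
   Context: $k\le n\le p$ are positive integers; $[k+1]=\{1,\dots,k+1\}$ and $[k+1,n]=\{k+1,\dots,n\}$; $\mathcal{S}^n$ is the space of $n\times n$ real symmetric matrices and $\mathcal{S}_+^n$ its subset of positive semidefinite matrices; $\langle\cdot,\cdot\rangle$ is the Frobenius inner product; $\operatorname{Diag}(x)$ is the diagonal matrix with diagonal $x$; $|\cdot|$ is entrywise absolute value. $\lambda(X)\in\mathbb{R}^n$ is the vector of eigenvalues of $X$ when $\mathcal{Q}\in\{\mathcal{S}_+^n,\mathcal{S}^n\}$ and of singular values when $\mathcal{Q}=\mathbb{R}^{n\times p}$. The function $f:\mathbb{R}^n\to\mathbb{R}$ is continuous, convex and symmetric (permutation-invariant), and in the case $\mathcal{Q}=\mathbb{R}^{n\times p}$ it is taken sign-invariant; sign-invariant means $f(\lambda)=f(|\lambda|)$ for all $\lambda$. In (i), (iii), (iv) $U$ is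 an $n\times n$ orthogonal matrix; in (ii) $U\in\mathbb{R}^{n\times n}$ and $V\in\mathbb{R}^{p\times n}$ have orthonormal columns. Setting: put $\mathcal{D}=\{X\in\mathcal{Q}:\operatorname{rank}(X)\le k,\ f(\lambda(X))\le0\}$ and consider $V_{\rm rel}:=\min_{X\in\operatorname{conv}(\mathcal{D})}\{\langle A_0,X\rangle: b_i^l\le\langle A_i,X\rangle\le b_i^u,\ i=1,\dots,m\}$, where $A_0,\dots,A_m$ are real matrices of the size of the elements of $\mathcal{Q}$, symmetric when $\mathcal{Q}\in\{\mathcal{S}_+^n,\mathcal{S}^n\}$, and $-\infty\le b_i^l\le b_i^u\le+\infty$. It is supposed that $V_{\rm rel}>-\infty$ and that $\operatorname{conv}(\mathcal{D})$ (the convex hull) contains no line. The matrix in the objective is $\tilde A:=-A_0+\sum_{i=1}^m((\mu_i^l)^*-(\mu_i^u)^* )A_i$, where $(\mu^l)^*,(\mu^u)^*\in\mathbb{R}_+^m$ are optimal dual multipliers, for the lower and upper bound constraints respectively, of a column generation master linear program, i.e. the problem defining $V_{\rm rel}$ with $X$ restricted to convex combinations of finitely many points of $\operatorname{conv}(\mathcal{D})$ plus nonnegative combinations of finitely many of its directions. $\tilde A$ is symmetric when $\mathcal{Q}\in\{\mathcal{S}_+^n,\mathcal{S}^n\}$. The problem $V_{\rm P}$ is the pricing problem of that column generation algorithm.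
   Formalization: Existence of X* is claimed only if all superlevel sets of the problem are bounded, or else exactly when the vector problem has a maximizer; in (iv) λ* must also satisfy λ*_i β_i ≥ 0 for all i; in (iii) with k = n the zero constraints on λ are dropped. *)

theory Defs
  imports "HOL-Analysis.Analysis"
begin

text \<open>
  The coordinates of \<open>\<real>\<^sup>n\<close> are indexed by a finite linearly ordered type \<open>'n\<close>
  with \<open>n = CARD('n)\<close>; \<open>pos\<close> is the order isomorphism from \<open>'n\<close> onto \<open>{1..n}\<close>.
  An \<open>n \<times> p\<close> matrix has type \<open>real^'p^'n\<close>, and on this type \<open>A \<bullet> X\<close> is the
  Frobenius inner product.
\<close>

definition pos :: "'n::{finite,linorder} \<Rightarrow> nat" where
  "pos i = card {j. j \<le> i}"

definition Diag :: "real^'n \<Rightarrow> real^'n^'n" where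
  "Diag v = (\<chi> i j. if i = j then v $ i else 0)"

definition sym_mats :: "(real^'n^'n) set" where
  "sym_mats = {X. transpose X = X}"

definition psd_mats :: "(real^'n^'n) set" where
  "psd_mats = {X \<in> sym_mats. \<forall>v. 0 \<le> v \<bullet> (X *v v)}"

text \<open>
  Eigenvalues are counted with algebraic multiplicity: they are the roots of the
  characteristic polynomial, listed in nonincreasing order. The description is
  unique, and it denotes for every symmetric matrix.
\<close>

definition eigvals :: "real^'n::{finite,linorder}^'n::{finite,linorder} \<Rightarrow> real^'n::{finite,linorder}" where
  "eigvals X = (THE l. antimono (($) l) \<and>
     (\<forall>x. det (x *\<^sub>R mat 1 - X) = (\<Prod>i\<in>UNIV. x - l $ i)))"

text \<open>Intended for \<open>n \<le> p\<close>, where an \<open>n \<times> p\<close> matrix has \<open>n\<close> singular values.\<close>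

definition singvals :: "real^'p^'n::{finite,linorder} \<Rightarrow> real^'n::{finite,linorder}" where
  "singvals X = (\<chi> i. sqrt (eigvals (X ** transpose X) $ i))"

definition symmetric_fun :: "(real^'n \<Rightarrow> real) \<Rightarrow> bool" where
  "symmetric_fun f \<longleftrightarrow> (\<forall>\<pi> x. \<pi> permutes UNIV \<longrightarrow> f (\<chi> i. x $ \<pi> i) = f x)"

definition sign_invariant :: "(real^'n \<Rightarrow> real) \<Rightarrow> bool" where
  "sign_invariant f \<longleftrightarrow> (\<forall>x. f x = f \<bar>x\<bar>)"

definition rank_domain ::
  "(real^'q^'n) set \<Rightarrow> (real^'q^'n \<Rightarrow> real^'n) \<Rightarrow> (real^'n \<Rightarrow> real) \<Rightarrow> nat \<Rightarrow> (real^'q^'n) set" where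
  "rank_domain Q lam f k = {X \<in> Q. rank X \<le> k \<and> f (lam X) \<le> 0}"

definition D_psd :: "(real^'n::{finite,linorder} \<Rightarrow> real) \<Rightarrow> nat \<Rightarrow> (real^'n::{finite,linorder}^'n::{finite,linorder}) set" where
  "D_psd f k = rank_domain psd_mats eigvals f k"

definition D_rect :: "(real^'n::{finite,linorder} \<Rightarrow> real) \<Rightarrow> nat \<Rightarrow> (real^'p^'n::{finite,linorder}) set" where
  "D_rect f k = rank_domain UNIV singvals f k"

definition D_sym :: "(real^'n::{finite,linorder} \<Rightarrow> real) \<Rightarrow> nat \<Rightarrow> (real^'n::{finite,linorder}^'n::{finite,linorder}) set" where
  "D_sym f k = rank_domain sym_mats eigvals f k"

definition pricing_opt :: "'a::real_inner set \<Rightarrow> 'a \<Rightarrow> 'a \<Rightarrow> bool" where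
  "pricing_opt D At X \<longleftrightarrow> is_arg_max (\<lambda>X. At \<bullet> X) (\<lambda>X. X \<in> D) X"

subsection \<open>The relaxation and its column generation master problem\<close>

text \<open>
  The family \<open>A\<close> collects the objective matrix \<open>A 0\<close> and the constraint matrices
  \<open>A 1, \<dots>, A m\<close>.
\<close>

definition bounds_ok ::
  "nat \<Rightarrow> (nat \<Rightarrow> 'a::real_inner) \<Rightarrow> (nat \<Rightarrow> ereal) \<Rightarrow> (nat \<Rightarrow> ereal) \<Rightarrow> 'a \<Rightarrow> bool" where
  "bounds_ok m A bl bu X \<longleftrightarrow>
     (\<forall>i\<in>{1..m}. bl i \<le> ereal (A i \<bullet> X) \<and> ereal (A i \<bullet> X) \<le> bu i)"

definition V_rel ::
  "'a::real_inner set \<Rightarrow> nat \<Rightarrow> (nat \<Rightarrow> 'a) \<Rightarrow> (nat \<Rightarrow> ereal) \<Rightarrow> (nat \<Rightarrow> ereal) \<Rightarrow> ereal" where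
  "V_rel D m A bl bu =
     (INF X \<in> {X \<in> convex hull D. bounds_ok m A bl bu X}. ereal (A 0 \<bullet> X))"

definition contains_line :: "'a::real_vector set \<Rightarrow> bool" where
  "contains_line C \<longleftrightarrow> (\<exists>x d. d \<noteq> 0 \<and> (\<forall>t. x + t *\<^sub>R d \<in> C))"

definition directions :: "'a::real_vector set \<Rightarrow> 'a set" where
  "directions C = {d. \<forall>x\<in>C. \<forall>t\<ge>0. x + t *\<^sub>R d \<in> C}"

definition master_set :: "'a::real_vector set \<Rightarrow> 'a set \<Rightarrow> 'a set" where
  "master_set H J =
     {x + (\<Sum>d\<in>J. c d *\<^sub>R d) | x c. x \<in> convex hull H \<and> (\<forall>d\<in>J. 0 \<le> c d)}"

text \<open>
  The master problem minimizes \<open>A 0 \<bullet> X\<close> over \<open>X \<in> master_set H J\<close> subject to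
  \<open>bounds_ok\<close>. As a linear program in the weights of the columns it has the dual
  below, where \<open>\<nu>\<close> belongs to the convexity constraint. An infinite bound is no
  constraint, so its multiplier is \<open>0\<close>.
\<close>

definition price_matrix ::
  "nat \<Rightarrow> (nat \<Rightarrow> 'a::real_vector) \<Rightarrow> (nat \<Rightarrow> real) \<Rightarrow> (nat \<Rightarrow> real) \<Rightarrow> 'a" where
  "price_matrix m A \<mu>l \<mu>u = - A 0 + (\<Sum>i=1..m. (\<mu>l i - \<mu>u i) *\<^sub>R A i)"

definition dual_feasible ::
  "'a::real_inner set \<Rightarrow> 'a set \<Rightarrow> nat \<Rightarrow> (nat \<Rightarrow> 'a) \<Rightarrow> (nat \<Rightarrow> ereal) \<Rightarrow> (nat \<Rightarrow> ereal) \<Rightarrow>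
   (nat \<Rightarrow> real) \<Rightarrow> (nat \<Rightarrow> real) \<Rightarrow> real \<Rightarrow> bool" where
  "dual_feasible H J m A bl bu \<mu>l \<mu>u \<nu> \<longleftrightarrow>
     (\<forall>i\<in>{1..m}. 0 \<le> \<mu>l i \<and> 0 \<le> \<mu>u i \<and>
        (bl i = -\<infinity> \<longrightarrow> \<mu>l i = 0) \<and> (bu i = \<infinity> \<longrightarrow> \<mu>u i = 0)) \<and>
     (\<forall>X\<in>H. \<nu> \<le> - (price_matrix m A \<mu>l \<mu>u \<bullet> X)) \<and>
     (\<forall>d\<in>J. 0 \<le> - (price_matrix m A \<mu>l \<mu>u \<bullet> d))"

text \<open>
  The map \<open>real_of_ereal\<close> sends both infinities to \<open>0\<close>. This only affects terms
  whose multiplier is \<open>0\<close>, because feasibility of the master problem, required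
  below, excludes \<open>bl i = \<infinity>\<close> and \<open>bu i = -\<infinity>\<close>.
\<close>

definition dual_objective ::
  "nat \<Rightarrow> (nat \<Rightarrow> ereal) \<Rightarrow> (nat \<Rightarrow> ereal) \<Rightarrow> (nat \<Rightarrow> real) \<Rightarrow> (nat \<Rightarrow> real) \<Rightarrow> real \<Rightarrow> real" where
  "dual_objective m bl bu \<mu>l \<mu>u \<nu> =
     \<nu> + (\<Sum>i=1..m. \<mu>l i * real_of_ereal (bl i) - \<mu>u i * real_of_ereal (bu i))"

definition optimal_multipliers ::
  "'a::real_inner set \<Rightarrow> 'a set \<Rightarrow> nat \<Rightarrow> (nat \<Rightarrow> 'a) \<Rightarrow> (nat \<Rightarrow> ereal) \<Rightarrow> (nat \<Rightarrow> ereal) \<Rightarrow>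
   (nat \<Rightarrow> real) \<Rightarrow> (nat \<Rightarrow> real) \<Rightarrow> bool" where
  "optimal_multipliers H J m A bl bu \<mu>l \<mu>u \<longleftrightarrow>
     (\<exists>X \<in> master_set H J. bounds_ok m A bl bu X) \<and>
     (\<exists>\<nu>. is_arg_max (\<lambda>(\<mu>l, \<mu>u, \<nu>). dual_objective m bl bu \<mu>l \<mu>u \<nu>)
            (\<lambda>(\<mu>l, \<mu>u, \<nu>). dual_feasible H J m A bl bu \<mu>l \<mu>u \<nu>) (\<mu>l, \<mu>u, \<nu>))"

definition pricing_setting ::
  "'a::real_inner set \<Rightarrow> nat \<Rightarrow> (nat \<Rightarrow> 'a) \<Rightarrow> (nat \<Rightarrow> ereal) \<Rightarrow> (nat \<Rightarrow> ereal) \<Rightarrow> 'a \<Rightarrow> bool" where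
  "pricing_setting D m A bl bu At \<longleftrightarrow>
     (\<forall>i\<in>{1..m}. bl i \<le> bu i) \<and>
     V_rel D m A bl bu > -\<infinity> \<and>
     \<not> contains_line (convex hull D) \<and>
     (\<exists>H J \<mu>l \<mu>u. finite H \<and> H \<subseteq> convex hull D \<and> finite J \<and> J \<subseteq> directions (convex hull D) \<and>
        optimal_multipliers H J m A bl bu \<mu>l \<mu>u \<and> At = price_matrix m A \<mu>l \<mu>u)"

text \<open>
  The setting does not make the supremum of the pricing problem attained: it may
  be infinite, and \<open>D\<close> may contain an unbounded sequence along which a finite
  supremum is only approached. Under the following condition this cannot happen;
  it holds whenever \<open>D\<close> is bounded.
\<close>

definition bounded_superlevels :: "'a::real_inner set \<Rightarrow> 'a \<Rightarrow> bool" where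
  "bounded_superlevels D At \<longleftrightarrow> (\<forall>c. bounded {X \<in> D. c \<le> At \<bullet> X})"

subsection \<open>The vector problems\<close>

definition opt_nonneg ::
  "nat \<Rightarrow> (real^'n::{finite,linorder} \<Rightarrow> real) \<Rightarrow> real^'n::{finite,linorder} \<Rightarrow>
   real^'n::{finite,linorder} \<Rightarrow> bool" where
  "opt_nonneg k f \<beta> = is_arg_max (\<lambda>l. l \<bullet> \<beta>)
     (\<lambda>l. (\<forall>i. 0 \<le> l $ i) \<and> (\<forall>i. pos i \<in> {k+1..CARD('n)} \<longrightarrow> l $ i = 0) \<and> f l \<le> 0)"

text \<open>
  The equations at the positions \<open>s\<close> and \<open>s + n - k - 1\<close> delimit a block of
  \<open>n - k\<close> zero entries. For \<open>k = n\<close> this block is empty and nothing is required.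
\<close>

definition opt_sorted ::
  "nat \<Rightarrow> (real^'n::{finite,linorder} \<Rightarrow> real) \<Rightarrow> real^'n::{finite,linorder} \<Rightarrow>
   real^'n::{finite,linorder} \<Rightarrow> bool" where
  "opt_sorted k f \<beta> = is_arg_max (\<lambda>l. l \<bullet> \<beta>)
     (\<lambda>l. \<exists>s\<in>{1..k+1}. antimono (($) l) \<and>
        (k < CARD('n) \<longrightarrow> (\<forall>i. pos i \<in> {s, s + CARD('n) - k - 1} \<longrightarrow> l $ i = 0)) \<and> f l \<le> 0)"

definition opt_abs ::
  "nat \<Rightarrow> (real^'n::{finite,linorder} \<Rightarrow> real) \<Rightarrow> real^'n::{finite,linorder} \<Rightarrow>
   real^'n::{finite,linorder} \<Rightarrow> bool" where
  "opt_abs k f \<beta> = is_arg_max (\<lambda>l. \<bar>l\<bar> \<bullet> \<bar>\<beta>\<bar>)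
     (\<lambda>l. (\<forall>i. pos i \<in> {k+1..CARD('n)} \<longrightarrow> \<bar>l $ i\<bar> = 0) \<and> f \<bar>l\<bar> \<le> 0)"

end

theory Submission
  imports Defs
begin

text \<open>
  The vector problems embed into the pricing problem by \<open>l \<mapsto> U ** Diag l ** transpose V\<close>
  (with \<open>V = U\<close> in the symmetric cases). This map is a linear isometry, it turns the
  objective \<open>At \<bullet> X\<close> into \<open>l \<bullet> \<beta>\<close>, and it sends feasible vectors to feasible matrices: the
  rank is the number of nonzero entries of \<open>l\<close>, and \<open>f\<close>, being symmetric, does not see
  that the eigenvalues (or singular values) of the image are the entries of \<open>l\<close> in
  another order.

  Conversely, every feasible matrix \<open>X\<close> is dominated by a feasible vector, namely its
  sorted eigenvalue or singular value vector, because of the trace inequality of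
  von Neumann: \<open>At \<bullet> X\<close> is at most the inner product of the sorted spectra of \<open>At\<close> and
  \<open>X\<close> (\<open>trace_inequality_sym\<close>, \<open>trace_inequality_rect\<close>, and \<open>trace_inequality_sym_abs\<close>
  for spectra sorted by absolute value). The reason for this inequality is that
  \<open>At \<bullet> X = (\<Sum>i. \<Sum>j. P i j * \<beta> $ i * \<lambda> $ j)\<close> where \<open>P\<close> holds the squared cosines between the two
  orthonormal eigenbases and is therefore doubly stochastic; for rectangular matrices
  there is the same bound with a doubly substochastic \<open>P\<close>. Such a mixture of two
  nonincreasing sequences, nonnegative ones if \<open>P\<close> is only substochastic, is largest when \<open>P\<close>
  is the identity (\<open>substochastic_rearrangement\<close>). The eigenbasis of \<open>X\<close> comes from
  \<open>spectral_decomposition\<close>.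

  So the two problems have the same value, and optimal vectors give optimal matrices.
  In the general symmetric case, sorting puts the \<open>n - k\<close> zero eigenvalues next to each
  other, between the positive and the negative ones, which is what the index \<open>s\<close> of the
  vector problem expresses (\<open>opt_sorted_iff\<close>). In the sign-invariant case the vector problem
  sees only absolute values, so the signs can be chosen to agree with those of \<open>\<beta>\<close>; the
  dominating vector is then made of the sorted absolute eigenvalues of \<open>X\<close>.

  Existence of an optimum is also read off from the vector problem. Its feasible set is
  closed since \<open>f\<close> is continuous, and the isometry makes its superlevel sets bounded
  whenever those of the pricing problem are, so that they are compact
  (\<open>pricing_by_vector_problem\<close>).
\<close>

section \<open>Sorting, and the characteristic polynomial of a diagonalized matrix\<close>

lemma sorting_permutation:
  fixes v :: "real^'n::{finite,linorder}"
  obtains \<pi> where "\<pi> permutes UNIV" "antimono (\<lambda>i. v $ \<pi> i)"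
proof -
  define xs where "xs = sorted_list_of_set (UNIV :: 'n set)"
  define ys where "ys = sort_key (\<lambda>i. - v $ i) xs"
  define idx where "idx = inv_into {..<CARD('n)} ((!) xs)"
  have len: "length xs = CARD('n)" "length ys = CARD('n)"
    by (simp_all add: xs_def ys_def)
  have bx: "bij_betw ((!) xs) {..<CARD('n)} UNIV"
    by (rule bij_betw_nth) (auto simp: xs_def)
  have bidx: "bij_betw idx UNIV {..<CARD('n)}"
    unfolding idx_def by (rule bij_betw_inv_into[OF bx])
  have byy: "bij_betw ((!) ys) {..<CARD('n)} UNIV"
    by (rule bij_betw_nth) (auto simp: xs_def ys_def)
  \<comment> \<open>The permutation sends the \<open>r\<close>-th index to the index of the \<open>r\<close>-th largest entry.\<close>
  have "bij ((!) ys \<circ> idx)"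
    using bidx byy by (rule bij_betw_trans)
  then have perm: "((!) ys \<circ> idx) permutes UNIV"
    by (rule bij_imp_permutes) simp
  have idx: "idx i < CARD('n)" "xs ! idx i = i" for i
    using bidx bx by (auto simp: bij_betw_def idx_def f_inv_into_f)
  have mono: "idx i \<le> idx j" if "i \<le> j" for i j
  proof (rule ccontr)
    assume "\<not> idx i \<le> idx j"
    moreover have "sorted_wrt (<) xs"
      by (simp add: xs_def)
    ultimately have "xs ! idx j < xs ! idx i"
      using idx(1)[of i] len(1) by (simp add: sorted_wrt_iff_nth_less)
    then show False using that idx by simp
  qed
  have "sorted (map (\<lambda>i. - v $ i) ys)"
    by (simp add: ys_def)
  then have "antimono (\<lambda>i. v $ (((!) ys \<circ> idx) i))"
    using mono idx len by (auto simp: antimono_def sorted_iff_nth_mono)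
  with perm show thesis by (rule that)
qed

text \<open>
  A nonincreasing function is determined by its superlevel sets. These are initial
  segments of the index type, so any two of them are comparable and equal
  cardinality makes them equal.
\<close>

lemma antimono_eq_if_same_multiset:
  fixes a b :: "'n::{finite,linorder} \<Rightarrow> real"
  assumes a: "antimono a" and b: "antimono b"
    and eq: "image_mset a (mset_set UNIV) = image_mset b (mset_set UNIV)"
  shows "a = b"
proof -
  have card_level: "card {i. t \<le> h i} = size (filter_mset ((\<le>) t) (image_mset h (mset_set UNIV)))"
    for t and h :: "'n \<Rightarrow> real"
    by (simp add: filter_mset_image_mset)
  have down: "{i. t \<le> a i} \<subseteq> {i. t \<le> b i} \<or> {i. t \<le> b i} \<subseteq> {i. t \<le> a i}" for t
    using a b unfolding antimono_def
    by (smt (verit, best) linorder_linear mem_Collect_eq subsetI)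
  have level: "{i. t \<le> a i} = {i. t \<le> b i}" for t
    using down[of t] card_level[of t a] card_level[of t b] eq
    by (metis card_subset_eq finite)
  show ?thesis
  proof
    fix i
    show "a i = b i"
      using level[of "a i"] level[of "b i"] by (auto simp: set_eq_iff intro: antisym)
  qed
qed

text \<open>
  Both products are polynomial functions, and a polynomial determines the multiset of its roots.
\<close>

lemma root_multiset_unique:
  fixes a b :: "'n::finite \<Rightarrow> real"
  assumes "\<And>x. (\<Prod>i\<in>UNIV. x - a i) = (\<Prod>i\<in>UNIV. x - b i)"
  shows "image_mset a (mset_set UNIV) = image_mset b (mset_set UNIV)"
proof -
  have roots: "proots (\<Prod>i\<in>UNIV. [:- h i, 1:]) = image_mset h (mset_set UNIV)" for h :: "'n \<Rightarrow> real"
    by (subst proots_prod) (auto simp: sum_unfold_sum_mset)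
  have "poly (\<Prod>i\<in>UNIV. [:- a i, 1:]) = poly (\<Prod>i\<in>UNIV. [:- b i, 1:])"
    using assms by (simp add: fun_eq_iff poly_prod)
  then show ?thesis
    by (metis poly_eq_poly_eq_iff roots)
qed

text \<open>
  The definite description in \<open>eigvals\<close> is well defined: the characteristic polynomial
  determines the multiset of eigenvalues, and sorting makes the vector unique.
\<close>

lemma eigvals_eqI:
  fixes X :: "real^'n::{finite,linorder}^'n::{finite,linorder}"
  assumes "antimono (($) l)"
    and "\<And>x. det (x *\<^sub>R mat 1 - X) = (\<Prod>i\<in>UNIV. x - l $ i)"
  shows "eigvals X = l"
  unfolding eigvals_def
proof (rule the_equality)
  fix l' :: "real^'n::{finite,linorder}"
  assume "antimono (($) l') \<and> (\<forall>x. det (x *\<^sub>R mat 1 - X) = (\<Prod>i\<in>UNIV. x - l' $ i))"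
  then have "($) l' = ($) l"
    using assms by (intro antimono_eq_if_same_multiset root_multiset_unique) auto
  then show "l' = l" by (simp add: vec_eq_iff)
qed (use assms in blast)

lemma Diag_matrix_mult:
  "(U ** Diag l) $ i $ j = U $ i $ j * l $ j" for U :: "real^'n^'m"
  by (simp add: matrix_matrix_mult_def Diag_def if_distrib cong: if_cong)

lemma matrix_diff_right: "A ** (B - C) = A ** B - A ** C" for A :: "real^'n^'m"
  by (simp add: matrix_matrix_mult_def vec_eq_iff right_diff_distrib sum_subtractf)

lemma matrix_diff_left: "(B - C) ** A = B ** A - C ** A" for A :: "real^'n^'m"
  by (simp add: matrix_matrix_mult_def vec_eq_iff left_diff_distrib sum_subtractf)

lemma matrix_mult_scaleR:
  "A ** (x *\<^sub>R B) = x *\<^sub>R (A ** B)" "(x *\<^sub>R A) ** B = x *\<^sub>R (A ** B)" for A :: "real^'n^'m"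
  by (simp_all add: matrix_matrix_mult_def vec_eq_iff sum_distrib_left mult_ac)

lemma det_conj_Diag:
  fixes U :: "real^'n^'n"
  assumes "orthogonal_matrix U"
  shows "det (x *\<^sub>R mat 1 - U ** Diag l ** transpose U) = (\<Prod>i\<in>UNIV. x - l $ i)"
proof -
  have UU: "U ** transpose U = mat 1"
    using assms by (simp add: orthogonal_matrix_def)
  have "Diag ((\<chi> i. x) - l) = x *\<^sub>R mat 1 - Diag l"
    by (simp add: Diag_def vec_eq_iff mat_def)
  then have "U ** Diag ((\<chi> i. x) - l) ** transpose U
      = x *\<^sub>R (U ** transpose U) - U ** Diag l ** transpose U"
    by (simp add: matrix_diff_right matrix_diff_left matrix_mult_scaleR)
  then have "det (x *\<^sub>R mat 1 - U ** Diag l ** transpose U)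
      = det U * det (Diag ((\<chi> i. x) - l)) * det (transpose U)"
    using UU by (metis det_mul)
  also have "\<dots> = det (Diag ((\<chi> i. x) - l))"
    using UU by (metis det_mul det_I mult.commute mult.left_commute mult_1)
  also have "\<dots> = (\<Prod>i\<in>UNIV. x - l $ i)"
    by (subst det_diagonal) (auto simp: Diag_def)
  finally show ?thesis .
qed

text \<open>
  For an unsorted diagonal, \<open>\<pi>\<close> is the permutation that brings the eigenvalues into the
  order that \<open>eigvals\<close> demands.
\<close>

lemma eigvals_conj_Diag:
  fixes U :: "real^'n::{finite,linorder}^'n::{finite,linorder}"
  assumes "orthogonal_matrix U" "\<pi> permutes UNIV" "antimono (\<lambda>i. l $ \<pi> i)"
  shows "eigvals (U ** Diag l ** transpose U) = (\<chi> i. l $ \<pi> i)"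
proof (rule eigvals_eqI)
  show "antimono (($) (\<chi> i. l $ \<pi> i))"
    using assms by (simp add: antimono_def)
  fix x
  show "det (x *\<^sub>R mat 1 - U ** Diag l ** transpose U) = (\<Prod>i\<in>UNIV. x - (\<chi> i. l $ \<pi> i) $ i)"
    using assms prod.permute[of \<pi> UNIV "\<lambda>i. x - l $ i"]
    by (simp add: det_conj_Diag o_def)
qed

lemma eigvals_conj_Diag_sorted:
  fixes U :: "real^'n::{finite,linorder}^'n::{finite,linorder}"
  assumes "orthogonal_matrix U" "antimono (($) l)"
  shows "eigvals (U ** Diag l ** transpose U) = l"
  using eigvals_conj_Diag[OF assms(1) permutes_id] assms(2) by simp

lemma f_eigvals_conj_Diag:
  fixes U :: "real^'n::{finite,linorder}^'n::{finite,linorder}"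
  assumes "orthogonal_matrix U" "symmetric_fun f"
  shows "f (eigvals (U ** Diag l ** transpose U)) = f l"
  by (metis assms eigvals_conj_Diag sorting_permutation symmetric_fun_def)

section \<open>The spectral theorem for real symmetric matrices\<close>

lemma sym_dot:
  fixes X :: "real^'n^'n"
  assumes "X \<in> sym_mats"
  shows "(X *v v) \<bullet> w = v \<bullet> (X *v w)"
  using assms by (metis (mono_tags) dot_lmul_matrix mem_Collect_eq sym_mats_def vector_transpose_matrix)

text \<open>
  The Rayleigh quotient attains its maximum \<open>c\<close> over the unit sphere of \<open>S\<close> at some \<open>u\<close>.
  Then the quadratic form \<open>g v = c * (v \<bullet> v) - v \<bullet> (X *v v)\<close> is nonnegative on \<open>S\<close> and
  vanishes at \<open>u\<close>. Its derivative at \<open>u\<close> in the direction \<open>r = c *\<^sub>R u - X *v u\<close>, which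
  stays in \<open>S\<close>, is \<open>2 * (r \<bullet> r)\<close>, so \<open>r\<close> must be \<open>0\<close>.
\<close>

lemma sym_invariant_eigenvector:
  fixes X :: "real^'n^'n"
  assumes X: "X \<in> sym_mats" and S: "subspace S" and inv: "\<And>v. v \<in> S \<Longrightarrow> X *v v \<in> S"
    and ne: "S \<noteq> {0}"
  obtains u c where "u \<in> S" "norm u = 1" "X *v u = c *\<^sub>R u"
proof -
  let ?K = "S \<inter> sphere 0 1"
  obtain x where x: "x \<in> S" "x \<noteq> 0"
    using ne subspace_0[OF S] by blast
  then have "(1 / norm x) *\<^sub>R x \<in> ?K"
    using S by (auto simp: subspace_scale)
  moreover have "compact ?K"
    using closed_subspace[OF S] by (simp add: closed_Int_compact)
  moreover have "continuous_on ?K (\<lambda>v. v \<bullet> (X *v v))"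
    by (intro continuous_intros linear_continuous_on matrix_vector_mul_bounded_linear)
  ultimately obtain u where u: "u \<in> ?K" and max: "\<And>v. v \<in> ?K \<Longrightarrow> v \<bullet> (X *v v) \<le> u \<bullet> (X *v u)"
    using continuous_attains_sup[of ?K "\<lambda>v. v \<bullet> (X *v v)"] by blast
  define c where "c = u \<bullet> (X *v u)"
  define g where "g v = c * (v \<bullet> v) - v \<bullet> (X *v v)" for v
  have uS: "u \<in> S" and nu: "norm u = 1" and uu: "u \<bullet> u = 1"
    using u by (auto simp: norm_eq_1)
  have g_nonneg: "0 \<le> g v" if "v \<in> S" for v
  proof (cases "v = 0")
    case True
    then show ?thesis by (simp add: g_def)
  next
    case False
    let ?w = "(1 / norm v) *\<^sub>R v"
    have "?w \<in> ?K"
      using False that S by (auto simp: subspace_scale)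
    then have "?w \<bullet> (X *v ?w) \<le> c"
      using max c_def by blast
    then have "v \<bullet> (X *v v) / (norm v)\<^sup>2 \<le> c"
      by (simp add: matrix_vector_mult_scaleR power2_eq_square)
    then show ?thesis
      using False by (simp add: g_def pos_divide_le_eq power2_norm_eq_inner)
  qed
  define r where "r = c *\<^sub>R u - X *v u"
  have rS: "r \<in> S"
    using S inv uS by (simp add: r_def subspace_diff subspace_scale)
  have g_line: "g (u + t *\<^sub>R r) = t * (2 * (r \<bullet> r) + t * g r)" for t
  proof -
    have "r \<bullet> r = c * (u \<bullet> r) - (X *v u) \<bullet> r"
      by (simp add: r_def inner_diff_left)
    then have rr: "r \<bullet> r = c * (u \<bullet> r) - u \<bullet> (X *v r)" "r \<bullet> (X *v u) = u \<bullet> (X *v r)"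
      using sym_dot[OF X, of u r] by (auto simp: inner_commute)
    show ?thesis
      unfolding rr(1) using rr(2) uu c_def
      by (simp add: g_def matrix_vector_right_distrib matrix_vector_mult_scaleR inner_add_left
          inner_add_right inner_commute[of r u] algebra_simps power2_eq_square)
  qed
  have "r = 0"
  proof (rule ccontr)
    assume "r \<noteq> 0"
    then have pos: "0 < r \<bullet> r" by simp
    \<comment> \<open>A step against the slope, short enough for the linear term to dominate;
      adding \<open>1\<close> keeps the denominator positive if \<open>g r = 0\<close>.\<close>
    define t where "t = - (r \<bullet> r) / (g r + 1)"
    have gr: "0 \<le> g r" using g_nonneg[OF rS] .
    have "t * g r \<ge> - (r \<bullet> r)"
      using gr pos by (simp add: t_def field_simps)
    then have "0 < 2 * (r \<bullet> r) + t * g r" using pos by linarith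
    moreover have "t < 0" using gr pos by (simp add: t_def divide_neg_pos)
    ultimately have "g (u + t *\<^sub>R r) < 0"
      by (simp add: g_line mult_neg_pos)
    moreover have "u + t *\<^sub>R r \<in> S"
      using S uS rS by (simp add: subspace_add subspace_scale)
    ultimately show False using g_nonneg by fastforce
  qed
  then have "X *v u = c *\<^sub>R u" by (simp add: r_def)
  with uS nu show thesis by (rule that)
qed

text \<open>
  An orthonormal set of eigenvectors of maximal size is a basis: its orthogonal
  complement is invariant under \<open>X\<close>, so a nonzero complement would contain a further
  eigenvector.
\<close>

lemma sym_orthonormal_eigenbasis:
  fixes X :: "real^'n^'n"
  assumes X: "X \<in> sym_mats"
  obtains B where "finite B" "card B = CARD('n)" "pairwise orthogonal B"
    "\<And>b. b \<in> B \<Longrightarrow> norm b = 1" "\<And>b. b \<in> B \<Longrightarrow> \<exists>c. X *v b = c *\<^sub>R b"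
proof -
  define P where "P B \<longleftrightarrow> pairwise orthogonal B \<and> (\<forall>b\<in>B. norm b = 1 \<and> (\<exists>c. X *v b = c *\<^sub>R b))"
    for B :: "(real^'n) set"
  have indep: "independent B" if "P B" for B
    using that by (intro pairwise_orthogonal_independent) (auto simp: P_def)
  then have bound: "card B < Suc CARD('n)" if "P B" for B
    using that independent_bound[of B] by fastforce
  have "P {}" by (simp add: P_def)
  then obtain B where PB: "P B" and max: "\<And>B'. P B' \<Longrightarrow> card B' \<le> card B"
    using ex_has_greatest_nat[of P "{}" card "Suc CARD('n)"] bound by blast
  have fin: "finite B" using indep[OF PB] independent_bound by blast
  define S where "S = {v. \<forall>b\<in>B. orthogonal b v}"
  have S: "subspace S"
    unfolding S_def by (rule subspace_orthogonal_to_vectors)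
  have inv: "X *v v \<in> S" if "v \<in> S" for v
    unfolding S_def
  proof safe
    fix b assume b: "b \<in> B"
    then obtain c where "X *v b = c *\<^sub>R b" using PB by (auto simp: P_def)
    then show "orthogonal b (X *v v)"
      using that b sym_dot[OF X, of b v] by (simp add: S_def orthogonal_def)
  qed
  have "S = {0}"
  proof (rule ccontr)
    assume "S \<noteq> {0}"
    then obtain u c where u: "u \<in> S" "norm u = 1" "X *v u = c *\<^sub>R u"
      using sym_invariant_eigenvector[OF X S inv] by metis
    have "u \<notin> B"
      using u by (auto simp: S_def orthogonal_def)
    moreover have "P (insert u B)"
      using PB u by (auto simp: P_def S_def pairwise_insert orthogonal_commute)
    ultimately show False
      using max[of "insert u B"] fin by simp
  qed
  have "x \<in> span B" for x
  proof -
    obtain y z where yz: "y \<in> span B" "\<And>w. w \<in> span B \<Longrightarrow> orthogonal z w" "x = y + z"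
      using orthogonal_subspace_decomp_exists[of B x] by metis
    then have "z \<in> S"
      by (auto simp: S_def orthogonal_commute span_base)
    then show ?thesis using \<open>S = {0}\<close> yz by simp
  qed
  then have "span B = UNIV" by blast
  then have "card B = CARD('n)"
    using dim_eq_card[of B UNIV] indep[OF PB] by simp
  with PB fin that show thesis by (auto simp: P_def)
qed

theorem spectral_decomposition:
  fixes X :: "real^'n::{finite,linorder}^'n::{finite,linorder}"
  assumes X: "X \<in> sym_mats"
  obtains W where "orthogonal_matrix W" "X = W ** Diag (eigvals X) ** transpose W"
    "antimono (($) (eigvals X))"
proof -
  obtain B where B: "finite B" "card B = CARD('n)" "pairwise orthogonal B"
    "\<And>b. b \<in> B \<Longrightarrow> norm b = 1" "\<And>b. b \<in> B \<Longrightarrow> \<exists>c. X *v b = c *\<^sub>R b"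
    using sym_orthonormal_eigenbasis[OF X] by blast
  obtain e where e: "bij_betw e (UNIV :: 'n set) B"
    using B(1,2) finite_same_card_bij[of "UNIV :: 'n set" B] by auto
  have "\<forall>i. \<exists>c. X *v e i = c *\<^sub>R e i"
    using B(5) e by (auto simp: bij_betw_def)
  then obtain c where c: "\<And>i. X *v e i = c i *\<^sub>R e i" by metis
  obtain \<pi> where \<pi>: "\<pi> permutes UNIV" "antimono (\<lambda>i. (\<chi> i. c i) $ \<pi> i)"
    using sorting_permutation by blast
  define l where "l = (\<chi> i. c (\<pi> i))"
  define W where "W = (\<chi> i j. e (\<pi> j) $ i)"
  have col: "column j W = e (\<pi> j)" for j
    by (simp add: W_def column_def vec_eq_iff)
  have e\<pi>: "bij_betw (\<lambda>i. e (\<pi> i)) UNIV B"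
    using bij_betw_trans[OF permutes_bij[OF \<pi>(1)] e] by (simp add: o_def)
  have orth: "orthogonal_matrix W"
    unfolding orthogonal_matrix_orthonormal_columns col
  proof safe
    have mem: "e (\<pi> i) \<in> B" for i
      using e\<pi> by (auto simp: bij_betw_def)
    show "norm (e (\<pi> i)) = 1" for i
      using B(4) mem by blast
    show "orthogonal (e (\<pi> i)) (e (\<pi> j))" if "i \<noteq> j" for i j
      using B(3) mem that bij_betw_imp_inj_on[OF e\<pi>] unfolding pairwise_def inj_def by metis
  qed
  have "X ** W = W ** Diag l"
  proof -
    have "(X ** W) $ i $ j = (X *v column j W) $ i" for i j
      by (simp add: matrix_matrix_mult_def matrix_vector_mult_def column_def)
    then show ?thesis
      by (simp add: vec_eq_iff col c Diag_matrix_mult l_def) (simp add: W_def)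
  qed
  then have XW: "X = W ** Diag l ** transpose W"
    using orth by (metis matrix_mul_assoc matrix_mul_rid orthogonal_matrix_def)
  have "antimono (($) l)"
    using \<pi>(2) by (simp add: l_def antimono_def)
  moreover from this have "eigvals X = l"
    using eigvals_conj_Diag_sorted[OF orth] XW by simp
  ultimately show thesis using that orth XW by simp
qed

section \<open>Rearrangement under doubly substochastic weights\<close>

definition initial_segment :: "'a::linorder set \<Rightarrow> bool" where
  "initial_segment D \<longleftrightarrow> (\<forall>i\<in>D. \<forall>j\<le>i. j \<in> D)"

lemma initial_segments_chain:
  "initial_segment D \<Longrightarrow> initial_segment E \<Longrightarrow> D \<subseteq> E \<or> E \<subseteq> D"
  unfolding initial_segment_def by (meson linorder_linear subsetI)

text \<open>
  Summation by parts: a nonnegative nonincreasing \<open>a\<close> is a nonnegative combination of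
  indicators of initial segments. The induction adds the indices in increasing
  order and compares with the constant weight \<open>c\<close>, which must stay below all
  weights met so far.
\<close>

lemma antimono_weighted_sum_nonneg:
  fixes a g :: "'n::{finite,linorder} \<Rightarrow> real"
  assumes a: "antimono a" "\<And>i. 0 \<le> a i"
    and g: "\<And>D. initial_segment D \<Longrightarrow> 0 \<le> (\<Sum>i\<in>D. g i)"
  shows "0 \<le> (\<Sum>i\<in>UNIV. a i * g i)"
proof -
  have "\<lbrakk>initial_segment A; \<And>i. i \<in> A \<Longrightarrow> c \<le> a i; 0 \<le> c\<rbrakk> \<Longrightarrow>
      c * (\<Sum>i\<in>A. g i) \<le> (\<Sum>i\<in>A. a i * g i)" for A c
    using finite[of A]
  proof (induction A arbitrary: c rule: finite_linorder_max_induct)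
    case empty
    then show ?case by simp
  next
    case (insert b A)
    have b: "b \<notin> A" using insert.hyps(2) by blast
    have "initial_segment A"
      using insert.prems(1) insert.hyps(2) unfolding initial_segment_def
      by (metis insert_iff leD order_le_less_trans)
    moreover have "a b \<le> a i" if "i \<in> A" for i
      using a(1) insert.hyps(2) that by (simp add: antimono_def less_imp_le)
    ultimately have "a b * (\<Sum>i\<in>A. g i) \<le> (\<Sum>i\<in>A. a i * g i)"
      using insert.IH a(2) by blast
    moreover have "c * (\<Sum>i\<in>insert b A. g i) \<le> a b * (\<Sum>i\<in>insert b A. g i)"
      using g insert.prems by (intro mult_right_mono) auto
    ultimately show ?case
      using b insert.hyps(1) by (simp add: distrib_left)
  qed
  from this[of UNIV 0] show ?thesis
    using a(2) by (simp add: initial_segment_def)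
qed

text \<open>
  By summation by parts in both variables it suffices to let \<open>a\<close> and \<open>b\<close> be indicators of
  initial segments \<open>D\<close> and \<open>E\<close>. The inequality then bounds the mass of the block \<open>D \<times> E\<close> of \<open>P\<close>
  by the size of the smaller of the two segments, which is a row or a column bound.
\<close>

lemma substochastic_rearrangement:
  fixes a b :: "'n::{finite,linorder} \<Rightarrow> real"
  assumes a: "antimono a" "\<And>i. 0 \<le> a i" and b: "antimono b" "\<And>i. 0 \<le> b i"
    and P: "\<And>i j. 0 \<le> P i j"
    and row: "\<And>i. (\<Sum>j\<in>UNIV. P i j) \<le> 1" and col: "\<And>j. (\<Sum>i\<in>UNIV. P i j) \<le> 1"
  shows "(\<Sum>i\<in>UNIV. \<Sum>j\<in>UNIV. P i j * a i * b j) \<le> (\<Sum>i\<in>UNIV. a i * b i)"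
proof -
  have block: "(\<Sum>i\<in>D. \<Sum>j\<in>E. P i j) \<le> card (D \<inter> E)"
    if D: "initial_segment D" and E: "initial_segment E" for D E
  proof (cases "D \<subseteq> E")
    case True
    have "(\<Sum>i\<in>D. \<Sum>j\<in>E. P i j) \<le> (\<Sum>i\<in>D. \<Sum>j\<in>UNIV. P i j)"
      by (intro sum_mono sum_mono2) (auto simp: P)
    also have "\<dots> \<le> (\<Sum>i\<in>D. 1)"
      by (intro sum_mono row)
    finally show ?thesis using True by (simp add: Int_absorb2)
  next
    case False
    then have "E \<subseteq> D" using initial_segments_chain[OF D E] by blast
    have "(\<Sum>j\<in>E. \<Sum>i\<in>D. P i j) \<le> (\<Sum>j\<in>E. \<Sum>i\<in>UNIV. P i j)"
      by (intro sum_mono sum_mono2) (auto simp: P)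
    also have "\<dots> \<le> (\<Sum>j\<in>E. 1)"
      by (intro sum_mono col)
    finally show ?thesis using \<open>E \<subseteq> D\<close> by (simp add: Int_absorb1 sum.swap[of _ E D])
  qed
  have inner: "0 \<le> (\<Sum>i\<in>D. b i - (\<Sum>j\<in>UNIV. P i j * b j))" if D: "initial_segment D" for D
  proof -
    define h where "h j = of_bool (j \<in> D) - (\<Sum>i\<in>D. P i j)" for j
    have "0 \<le> (\<Sum>j\<in>E. h j)" if "initial_segment E" for E
    proof -
      have "(\<Sum>j\<in>E. h j) = card (D \<inter> E) - (\<Sum>i\<in>D. \<Sum>j\<in>E. P i j)"
        by (simp add: h_def sum_subtractf sum.swap[of _ E D] of_bool_def sum.If_cases Int_commute)
      then show ?thesis using block[OF D that] by simp
    qed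
    then have "0 \<le> (\<Sum>j\<in>UNIV. b j * h j)"
      using b by (intro antimono_weighted_sum_nonneg)
    also have "\<dots> = (\<Sum>j\<in>D. b j) - (\<Sum>j\<in>UNIV. \<Sum>i\<in>D. P i j * b j)"
      by (simp add: h_def right_diff_distrib sum_subtractf sum_distrib_left mult.commute
          of_bool_def sum.If_cases if_distrib[of "\<lambda>x. _ * x"])
    also have "\<dots> = (\<Sum>i\<in>D. b i - (\<Sum>j\<in>UNIV. P i j * b j))"
      by (simp add: sum_subtractf sum.swap[of _ D UNIV])
    finally show ?thesis .
  qed
  have "0 \<le> (\<Sum>i\<in>UNIV. a i * (b i - (\<Sum>j\<in>UNIV. P i j * b j)))"
    using a inner by (intro antimono_weighted_sum_nonneg)
  also have "\<dots> = (\<Sum>i\<in>UNIV. a i * b i) - (\<Sum>i\<in>UNIV. \<Sum>j\<in>UNIV. P i j * a i * b j)"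
    by (simp add: right_diff_distrib sum_subtractf sum_distrib_left mult_ac)
  finally show ?thesis by simp
qed

text \<open>
  Subtracting the minima from \<open>a\<close> and \<open>b\<close> makes them nonnegative. It changes both sides
  by the same amount, because all rows and columns of \<open>P\<close> sum to exactly \<open>1\<close>.
\<close>

lemma doubly_stochastic_rearrangement:
  fixes a b :: "'n::{finite,linorder} \<Rightarrow> real"
  assumes a: "antimono a" and b: "antimono b" and P: "\<And>i j. 0 \<le> P i j"
    and row: "\<And>i. (\<Sum>j\<in>UNIV. P i j) = 1" and col: "\<And>j. (\<Sum>i\<in>UNIV. P i j) = 1"
  shows "(\<Sum>i\<in>UNIV. \<Sum>j\<in>UNIV. P i j * a i * b j) \<le> (\<Sum>i\<in>UNIV. a i * b i)"
proof -
  define p q where "p = Min (range a)" and "q = Min (range b)"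
  have "p \<le> a i" "q \<le> b i" for i
    by (simp_all add: p_def q_def)
  then have le: "(\<Sum>i\<in>UNIV. \<Sum>j\<in>UNIV. P i j * (a i - p) * (b j - q))
      \<le> (\<Sum>i\<in>UNIV. (a i - p) * (b i - q))"
    using a b by (intro substochastic_rearrangement) (auto simp: antimono_def P row col)
  have 1: "(\<Sum>i\<in>UNIV. \<Sum>j\<in>UNIV. P i j * a i) = (\<Sum>i\<in>UNIV. a i)"
    by (simp add: row flip: sum_distrib_right)
  have 2: "(\<Sum>i\<in>UNIV. \<Sum>j\<in>UNIV. P i j * b j) = (\<Sum>j\<in>UNIV. b j)"
    by (subst sum.swap) (simp add: col flip: sum_distrib_right)
  have "(\<Sum>i\<in>UNIV. \<Sum>j\<in>UNIV. P i j * (a i - p) * (b j - q))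
      = (\<Sum>i\<in>UNIV. \<Sum>j\<in>UNIV. P i j * a i * b j - q * (P i j * a i) - p * (P i j * b j) + p * q * P i j)"
    by (intro sum.cong refl) (simp add: algebra_simps)
  also have "\<dots> = (\<Sum>i\<in>UNIV. \<Sum>j\<in>UNIV. P i j * a i * b j) - q * (\<Sum>i\<in>UNIV. a i)
      - p * (\<Sum>i\<in>UNIV. b i) + p * q * CARD('n)"
    by (simp add: sum.distrib sum_subtractf row 1 2 flip: sum_distrib_left)
  finally show ?thesis
    using le by (simp add: algebra_simps sum.distrib sum_subtractf flip: sum_distrib_left sum_distrib_right)
qed

section \<open>Inner products with diagonalized matrices\<close>

text \<open>
  The family may contain zero vectors. They occur below as normalized images of
  vectors that belong to a vanishing singular value.
\<close>

lemma bessel_inequality_indexed: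
  fixes z :: "'j::finite \<Rightarrow> 'a::real_inner"
  assumes "\<And>i j. i \<noteq> j \<Longrightarrow> z i \<bullet> z j = 0" "\<And>j. z j \<bullet> z j \<le> 1"
  shows "(\<Sum>j\<in>UNIV. (z j \<bullet> v)\<^sup>2) \<le> v \<bullet> v"
proof -
  define p where "p = (\<Sum>j\<in>UNIV. (z j \<bullet> v) *\<^sub>R z j)"
  have pv: "p \<bullet> v = (\<Sum>j\<in>UNIV. (z j \<bullet> v)\<^sup>2)"
    by (simp add: p_def inner_sum_left power2_eq_square)
  have "p \<bullet> z j = (z j \<bullet> v) * (z j \<bullet> z j)" for j
  proof -
    have "p \<bullet> z j = (\<Sum>i\<in>UNIV. if i = j then (z j \<bullet> v) * (z j \<bullet> z j) else 0)"
      unfolding p_def inner_sum_left using assms(1) by (intro sum.cong) auto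
    then show ?thesis by simp
  qed
  then have "p \<bullet> p = (\<Sum>j\<in>UNIV. (z j \<bullet> v)\<^sup>2 * (z j \<bullet> z j))"
    by (subst (2) p_def) (simp add: inner_sum_right power2_eq_square mult.assoc)
  also have "\<dots> \<le> p \<bullet> v"
    unfolding pv using assms(2) by (intro sum_mono) (simp add: mult_left_le)
  finally have "p \<bullet> p \<le> p \<bullet> v" .
  moreover have "0 \<le> (v - p) \<bullet> (v - p)" by simp
  ultimately have "p \<bullet> v \<le> v \<bullet> v"
    by (simp add: inner_diff_left inner_diff_right inner_commute)
  then show ?thesis by (simp add: pv)
qed

lemma inner_column:
  "transpose V ** V = mat 1 \<Longrightarrow> column i V \<bullet> column j V = (if i = j then 1 else 0)"
  for V :: "real^'n^'p"
proof -
  assume "transpose V ** V = mat 1"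
  moreover have "(transpose V ** V) $ i $ j = column i V \<bullet> column j V"
    by (simp add: matrix_matrix_mult_def transpose_def column_def inner_vec_def)
  ultimately show ?thesis by (simp add: mat_def)
qed

lemma inner_conj_Diag:
  fixes U :: "real^'n^'m" and V :: "real^'n^'p"
  shows "(U ** Diag b ** transpose V) \<bullet> X = (\<Sum>i\<in>UNIV. b $ i * (column i U \<bullet> (X *v column i V)))"
proof -
  have "(U ** Diag b ** transpose V) \<bullet> X
      = (\<Sum>x\<in>UNIV. \<Sum>y\<in>UNIV. \<Sum>i\<in>UNIV. U $ x $ i * b $ i * V $ y $ i * X $ x $ y)"
    by (simp add: inner_vec_def Diag_matrix_mult matrix_matrix_mult_def[of "U ** Diag b"] transpose_def
        sum_distrib_right)
  also have "\<dots> = (\<Sum>x\<in>UNIV. \<Sum>i\<in>UNIV. \<Sum>y\<in>UNIV. U $ x $ i * b $ i * V $ y $ i * X $ x $ y)"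
    by (intro sum.cong refl sum.swap)
  also have "\<dots> = (\<Sum>i\<in>UNIV. \<Sum>x\<in>UNIV. \<Sum>y\<in>UNIV. U $ x $ i * b $ i * V $ y $ i * X $ x $ y)"
    by (rule sum.swap)
  also have "\<dots> = (\<Sum>i\<in>UNIV. b $ i * (column i U \<bullet> (X *v column i V)))"
    by (simp add: inner_vec_def column_def matrix_vector_mult_def sum_distrib_left mult_ac)
  finally show ?thesis .
qed

lemma conj_Diag_mult_column:
  fixes U :: "real^'n^'m" and V :: "real^'n^'p"
  assumes "transpose V ** V = mat 1"
  shows "(U ** Diag l ** transpose V) *v column i V = l $ i *\<^sub>R column i U"
proof -
  have "(U ** Diag l ** transpose V) *v column i V = column i (U ** Diag l ** (transpose V ** V))"
    unfolding matrix_mul_assoc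
    by (simp add: vec_eq_iff column_def matrix_vector_mult_def matrix_matrix_mult_def[of _ V])
  then show ?thesis
    using assms by (simp add: vec_eq_iff column_def Diag_matrix_mult)
qed

lemma inner_conj_Diag_conj_Diag:
  fixes U :: "real^'n^'n" and V :: "real^'n^'p"
  assumes "orthogonal_matrix U" "transpose V ** V = mat 1"
  shows "(U ** Diag b ** transpose V) \<bullet> (U ** Diag l ** transpose V) = l \<bullet> b"
proof -
  have "transpose U ** U = mat 1" using assms by (simp add: orthogonal_matrix)
  then show ?thesis
    unfolding inner_conj_Diag conj_Diag_mult_column[OF assms(2)]
    by (simp add: inner_column inner_vec_def[of l] mult.commute)
qed

lemma orthogonal_matrix_parseval:
  fixes W :: "real^'n^'n"
  assumes "orthogonal_matrix W"
  shows "u \<bullet> v = (\<Sum>j\<in>UNIV. (column j W \<bullet> u) * (column j W \<bullet> v))"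
proof -
  have "u \<bullet> v = (transpose W *v u) \<bullet> (transpose W *v v)"
    using assms by (metis dot_lmul_matrix matrix_vector_mul_assoc matrix_vector_mul_lid
        orthogonal_matrix_def transpose_transpose vector_transpose_matrix)
  then show ?thesis
    by (simp add: inner_vec_def[of "transpose W *v u"] matrix_vector_mult_def transpose_def
        inner_vec_def column_def)
qed

section \<open>Positions, supports and rank\<close>

lemma pos_le_iff: "pos i \<le> pos j \<longleftrightarrow> i \<le> j"
proof -
  have "pos a < pos b" if "a < b" for a b :: 'a
    unfolding pos_def
  proof (rule psubset_card_mono)
    have "b \<in> {j. j \<le> b} - {j. j \<le> a}" using that by simp
    then show "{j. j \<le> a} \<subset> {j. j \<le> b}" using that by fastforce
  qed simp
  moreover have "pos a \<le> pos b" if "a \<le> b" for a b :: 'a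
    unfolding pos_def using that by (intro card_mono) auto
  ultimately show ?thesis by (metis leD leI)
qed

lemma bij_betw_pos: "bij_betw pos (UNIV :: 'n::{finite,linorder} set) {1..CARD('n)}"
proof -
  have inj: "inj (pos :: 'n \<Rightarrow> nat)"
    by (rule injI) (metis order_antisym order_refl pos_le_iff)
  have "1 \<le> pos i" for i :: 'n
    unfolding pos_def by (auto simp: Suc_le_eq card_gt_0_iff)
  moreover have "pos i \<le> CARD('n)" for i :: 'n
    unfolding pos_def by (rule card_mono) auto
  ultimately have "range (pos :: 'n \<Rightarrow> nat) \<subseteq> {1..CARD('n)}" by auto
  then have "range (pos :: 'n \<Rightarrow> nat) = {1..CARD('n)}"
    by (rule card_subset_eq[rotated]) (simp_all add: card_image inj)
  with inj show ?thesis by (simp add: bij_betw_def)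
qed

lemma card_pos_in:
  assumes "S \<subseteq> {1..CARD('n)}"
  shows "card {i :: 'n::{finite,linorder}. pos i \<in> S} = card S"
proof -
  have "pos ` {i :: 'n. pos i \<in> S} = S"
    using assms bij_betw_pos[where 'n='n] by (auto simp: bij_betw_def)
  moreover have "inj_on pos {i :: 'n. pos i \<in> S}"
    using bij_betw_pos[where 'n='n] by (auto simp: bij_betw_def inj_on_def)
  ultimately show ?thesis by (metis card_image)
qed

lemma pos_range: "pos i \<in> {1..CARD('n)}" for i :: "'n::{finite,linorder}"
  using bij_betw_pos by (auto simp: bij_betw_def)

lemma ex_pos: "r \<in> {1..CARD('n)} \<Longrightarrow> \<exists>i :: 'n::{finite,linorder}. pos i = r"
  using bij_betw_pos[where 'n='n] unfolding bij_betw_def by (metis imageE)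

definition support :: "real^'n \<Rightarrow> 'n set" where
  "support l = {i. l $ i \<noteq> 0}"

lemma rank_Diag: "rank (Diag l) = card (support l)" for l :: "real^'n"
proof -
  have mult: "(Diag l *v x) $ i = l $ i * x $ i" for x i
    by (simp add: Diag_def matrix_vector_mult_def if_distrib[of "\<lambda>c. c * _"] cong: if_cong)
  have "range (\<lambda>x. Diag l *v x) = {x. \<forall>i. i \<notin> support l \<longrightarrow> x $ i = 0}"
  proof (intro equalityI subsetI)
    fix y :: "real^'n"
    assume y: "y \<in> {x. \<forall>i. i \<notin> support l \<longrightarrow> x $ i = 0}"
    then have "y = Diag l *v (\<chi> i. y $ i / l $ i)"
      by (auto simp: vec_eq_iff mult support_def)
    then show "y \<in> range (\<lambda>x. Diag l *v x)" by blast
  qed (auto simp: mult support_def)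
  then show ?thesis
    by (simp add: rank_dim_range dim_substandard_cart flip: dim_vec_eq)
qed

text \<open>
  This bound makes the matrices built from sparse vectors feasible; the reverse one,
  \<open>support_le_rank_conj_Diag\<close>, limits the number of nonzero eigenvalues of a given matrix.
\<close>

lemma rank_conj_Diag_le:
  fixes U :: "real^'n^'m" and V :: "real^'n^'p"
  shows "rank (U ** Diag l ** transpose V) \<le> card (support l)"
  by (metis order_trans rank_Diag rank_mul_le_left rank_mul_le_right)

lemma support_le_rank_conj_Diag:
  fixes W :: "real^'n^'n"
  assumes "orthogonal_matrix W"
  shows "card (support l) \<le> rank (W ** Diag l ** transpose W)"
proof -
  have "Diag l = transpose W ** (W ** Diag l ** transpose W) ** W"
    using assms by (metis matrix_mul_assoc matrix_mul_lid matrix_mul_rid orthogonal_matrix_def)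
  then show ?thesis
    by (metis order_trans rank_Diag rank_mul_le_left rank_mul_le_right)
qed

section \<open>Trace inequalities\<close>

lemma conj_Diag_sym:
  "U ** Diag l ** transpose U \<in> sym_mats"
proof -
  have "transpose (Diag l) = Diag l"
    by (simp add: Diag_def transpose_def vec_eq_iff)
  then show ?thesis
    by (simp add: sym_mats_def matrix_transpose_mul matrix_mul_assoc)
qed

lemma conj_Diag_quadratic_form:
  fixes W :: "real^'n^'n"
  assumes W: "orthogonal_matrix W"
  shows "u \<bullet> ((W ** Diag l ** transpose W) *v u) = (\<Sum>j\<in>UNIV. (column j W \<bullet> u)\<^sup>2 * l $ j)"
proof -
  let ?X = "W ** Diag l ** transpose W"
  have "transpose W ** W = mat 1" using W by (simp add: orthogonal_matrix)
  then have "column j W \<bullet> (?X *v u) = l $ j * (column j W \<bullet> u)" for j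
    using sym_dot[OF conj_Diag_sym, of W l "column j W" u] by (simp add: conj_Diag_mult_column)
  then show ?thesis
    by (subst orthogonal_matrix_parseval[OF W]) (simp add: power2_eq_square mult_ac)
qed

lemma conj_Diag_psd_iff:
  fixes W :: "real^'n^'n"
  assumes W: "orthogonal_matrix W"
  shows "W ** Diag l ** transpose W \<in> psd_mats \<longleftrightarrow> (\<forall>i. 0 \<le> l $ i)"
proof
  assume psd: "W ** Diag l ** transpose W \<in> psd_mats"
  have WW: "transpose W ** W = mat 1" using W by (simp add: orthogonal_matrix)
  show "\<forall>i. 0 \<le> l $ i"
  proof
    fix i
    have "0 \<le> column i W \<bullet> ((W ** Diag l ** transpose W) *v column i W)"
      using psd by (simp add: psd_mats_def)
    then show "0 \<le> l $ i"
      unfolding conj_Diag_mult_column[OF WW] by (simp add: inner_column[OF WW])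
  qed
next
  assume "\<forall>i. 0 \<le> l $ i"
  then show "W ** Diag l ** transpose W \<in> psd_mats"
    by (simp add: psd_mats_def conj_Diag_sym conj_Diag_quadratic_form[OF W] sum_nonneg)
qed

lemma inner_conj_Diag_expansion:
  fixes U W :: "real^'n^'n"
  assumes W: "orthogonal_matrix W"
  shows "(U ** Diag b ** transpose U) \<bullet> (W ** Diag l ** transpose W)
    = (\<Sum>i\<in>UNIV. \<Sum>j\<in>UNIV. (column j W \<bullet> column i U)\<^sup>2 * b $ i * l $ j)"
  by (simp add: inner_conj_Diag conj_Diag_quadratic_form[OF W] sum_distrib_left mult_ac)

text \<open>
  The squared cosines between two orthonormal bases form a doubly stochastic matrix, by
  the identity of Parseval for either basis.
\<close>

lemma orthostochastic:
  fixes U W :: "real^'n^'n"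
  assumes U: "orthogonal_matrix U" and W: "orthogonal_matrix W"
  shows "(\<Sum>j\<in>UNIV. (column j W \<bullet> column i U)\<^sup>2) = 1"
    and "(\<Sum>i\<in>UNIV. (column j W \<bullet> column i U)\<^sup>2) = 1"
proof -
  have norm1: "column i Z \<bullet> column i Z = 1" if "orthogonal_matrix Z" for i and Z :: "real^'n^'n"
    using that by (simp add: inner_column orthogonal_matrix)
  show "(\<Sum>j\<in>UNIV. (column j W \<bullet> column i U)\<^sup>2) = 1"
    using orthogonal_matrix_parseval[OF W, of "column i U" "column i U"] norm1[OF U]
    by (simp add: power2_eq_square)
  show "(\<Sum>i\<in>UNIV. (column j W \<bullet> column i U)\<^sup>2) = 1"
    using orthogonal_matrix_parseval[OF U, of "column j W" "column j W"] norm1[OF W]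
    by (simp add: power2_eq_square inner_commute)
qed

lemma trace_inequality_sym:
  fixes U X :: "real^'n::{finite,linorder}^'n::{finite,linorder}"
  assumes U: "orthogonal_matrix U" and X: "X \<in> sym_mats" and b: "antimono (($) b)"
  shows "(U ** Diag b ** transpose U) \<bullet> X \<le> eigvals X \<bullet> b"
proof -
  obtain W where W: "orthogonal_matrix W" "X = W ** Diag (eigvals X) ** transpose W"
    "antimono (($) (eigvals X))"
    using spectral_decomposition[OF X] .
  have "(U ** Diag b ** transpose U) \<bullet> X
      = (\<Sum>i\<in>UNIV. \<Sum>j\<in>UNIV. (column j W \<bullet> column i U)\<^sup>2 * b $ i * eigvals X $ j)"
    by (subst W(2)) (rule inner_conj_Diag_expansion[OF W(1)])
  also have "\<dots> \<le> (\<Sum>i\<in>UNIV. b $ i * eigvals X $ i)"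
    using b W(3) orthostochastic[OF U W(1)] by (intro doubly_stochastic_rearrangement) auto
  finally show ?thesis by (simp add: inner_vec_def mult.commute)
qed

text \<open>
  Replacing all factors by their absolute values only increases the double sum; the
  permutation \<open>\<pi>\<close> then sorts the columns of the doubly stochastic matrix by \<open>\<bar>\<lambda>\<bar>\<close>.
\<close>

lemma trace_inequality_sym_abs:
  fixes U X :: "real^'n::{finite,linorder}^'n::{finite,linorder}"
  assumes U: "orthogonal_matrix U" and X: "X \<in> sym_mats" and b: "antimono (\<lambda>i. \<bar>b $ i\<bar>)"
    and \<pi>: "\<pi> permutes UNIV" "antimono (\<lambda>i. \<bar>eigvals X $ \<pi> i\<bar>)"
  shows "(U ** Diag b ** transpose U) \<bullet> X \<le> (\<Sum>i\<in>UNIV. \<bar>b $ i\<bar> * \<bar>eigvals X $ \<pi> i\<bar>)"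
proof -
  obtain W where W: "orthogonal_matrix W" "X = W ** Diag (eigvals X) ** transpose W"
    using spectral_decomposition[OF X] .
  define P where "P i j = (column j W \<bullet> column i U)\<^sup>2" for i j
  have P: "0 \<le> P i j" "(\<Sum>j\<in>UNIV. P i j) = 1" "(\<Sum>i\<in>UNIV. P i j) = 1" for i j
    using orthostochastic[OF U W(1)] by (simp_all add: P_def)
  have permute: "(\<Sum>j\<in>UNIV. h (\<pi> j)) = (\<Sum>j\<in>UNIV. h j)" for h :: "'n \<Rightarrow> real"
    using sum.permute[OF \<pi>(1), of h] by (simp add: o_def)
  have "(U ** Diag b ** transpose U) \<bullet> X
      = (\<Sum>i\<in>UNIV. \<Sum>j\<in>UNIV. P i j * b $ i * eigvals X $ j)"
    unfolding P_def by (subst W(2)) (rule inner_conj_Diag_expansion[OF W(1)])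
  also have "\<dots> \<le> (\<Sum>i\<in>UNIV. \<Sum>j\<in>UNIV. P i j * \<bar>b $ i\<bar> * \<bar>eigvals X $ j\<bar>)"
  proof (intro sum_mono)
    fix i j
    have "P i j * b $ i * eigvals X $ j \<le> \<bar>P i j * b $ i * eigvals X $ j\<bar>" by simp
    then show "P i j * b $ i * eigvals X $ j \<le> P i j * \<bar>b $ i\<bar> * \<bar>eigvals X $ j\<bar>"
      using P(1)[of i j] by (simp add: abs_mult)
  qed
  also have "\<dots> = (\<Sum>i\<in>UNIV. \<Sum>j\<in>UNIV. P i (\<pi> j) * \<bar>b $ i\<bar> * \<bar>eigvals X $ \<pi> j\<bar>)"
    by (intro sum.cong refl permute[symmetric])
  also have "\<dots> \<le> (\<Sum>i\<in>UNIV. \<bar>b $ i\<bar> * \<bar>eigvals X $ \<pi> i\<bar>)"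
    using b \<pi>(2) P by (intro substochastic_rearrangement) (auto simp: permute)
  finally show ?thesis .
qed

text \<open>
  The columns of \<open>W\<close> are left singular vectors of \<open>X\<close>: an eigenbasis of its positive
  semidefinite Gram matrix, whose eigenvalues are the squared singular values.
\<close>

lemma singvals_gram:
  fixes X :: "real^'p^'n::{finite,linorder}"
  obtains W where "orthogonal_matrix W"
    "X ** transpose X = W ** Diag (\<chi> i. (singvals X $ i)\<^sup>2) ** transpose W"
    "antimono (($) (singvals X))" "\<And>i. 0 \<le> singvals X $ i"
proof -
  have sym: "X ** transpose X \<in> sym_mats"
    by (simp add: sym_mats_def matrix_transpose_mul)
  have "v \<bullet> ((X ** transpose X) *v v) = (transpose X *v v) \<bullet> (transpose X *v v)" for v
    by (metis dot_lmul_matrix matrix_vector_mul_assoc transpose_transpose vector_transpose_matrix)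
  then have psd: "X ** transpose X \<in> psd_mats"
    using sym by (simp add: psd_mats_def)
  obtain W where W: "orthogonal_matrix W"
    "X ** transpose X = W ** Diag (eigvals (X ** transpose X)) ** transpose W"
    "antimono (($) (eigvals (X ** transpose X)))"
    using spectral_decomposition[OF sym] .
  have nonneg: "0 \<le> eigvals (X ** transpose X) $ i" for i
    using psd W conj_Diag_psd_iff by metis
  have "(\<chi> i. (singvals X $ i)\<^sup>2) = eigvals (X ** transpose X)"
    using nonneg by (simp add: singvals_def vec_eq_iff)
  then show thesis
    using W nonneg by (intro that[of W]) (auto simp: singvals_def antimono_def)
qed

text \<open>
  Each left singular vector \<open>w j\<close> of \<open>X\<close> satisfies \<open>transpose X *v w j = s j *\<^sub>R z j\<close>, where the
  \<open>z j\<close> are pairwise orthogonal and either unit vectors or \<open>0\<close>. Hence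
  \<open>u i \<bullet> (X *v v i) = (\<Sum>j. s j * (w j \<bullet> u i) * (z j \<bullet> v i))\<close>. Bounding each product of two cosines by
  the mean of their squares leaves weights that are doubly substochastic, by the
  inequality of Bessel.
\<close>

lemma trace_inequality_rect:
  fixes U :: "real^'n::{finite,linorder}^'n::{finite,linorder}" and V :: "real^'n::{finite,linorder}^'p"
    and X :: "real^'p^'n::{finite,linorder}"
  assumes U: "orthogonal_matrix U" and V: "transpose V ** V = mat 1"
    and b: "antimono (($) b)" "\<And>i. 0 \<le> b $ i"
  shows "(U ** Diag b ** transpose V) \<bullet> X \<le> singvals X \<bullet> b"
proof -
  let ?s = "singvals X"
  obtain W where W: "orthogonal_matrix W"
    "X ** transpose X = W ** Diag (\<chi> i. (?s $ i)\<^sup>2) ** transpose W"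
    and s: "antimono (($) ?s)" "\<And>i. 0 \<le> ?s $ i"
    using singvals_gram[of X] by blast
  have WW: "transpose W ** W = mat 1" using W(1) by (simp add: orthogonal_matrix)
  define y where "y j = transpose X *v column j W" for j
  \<comment> \<open>Division by zero makes \<open>z j = 0\<close> for a vanishing singular value, where also \<open>y j = 0\<close>.\<close>
  define z where "z j = (1 / ?s $ j) *\<^sub>R y j" for j
  have yy: "y i \<bullet> y j = (if i = j then (?s $ i)\<^sup>2 else 0)" for i j
  proof -
    have "y i \<bullet> y j = column i W \<bullet> ((X ** transpose X) *v column j W)"
      unfolding y_def
      by (metis dot_lmul_matrix matrix_vector_mul_assoc transpose_transpose vector_transpose_matrix)
    also have "\<dots> = (if i = j then (?s $ i)\<^sup>2 else 0)"
      unfolding W(2) conj_Diag_mult_column[OF WW] by (simp add: inner_column[OF WW])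
    finally show ?thesis .
  qed
  have y: "y j = ?s $ j *\<^sub>R z j" for j
    using yy[of j j] by (cases "?s $ j = 0") (simp_all add: z_def)
  have z: "z i \<bullet> z j = 0" if "i \<noteq> j" for i j
    using that by (simp add: z_def yy)
  have z1: "z j \<bullet> z j \<le> 1" for j
    by (simp add: z_def yy power2_eq_square)
  define P where "P i j = ((column j W \<bullet> column i U)\<^sup>2 + (z j \<bullet> column i V)\<^sup>2) / 2" for i j
  have P_nonneg: "0 \<le> P i j" for i j
    by (simp add: P_def)
  have row: "(\<Sum>j\<in>UNIV. P i j) \<le> 1" for i
    using orthostochastic(1)[OF U W(1), of i] bessel_inequality_indexed[of z "column i V"] z z1
    by (simp add: P_def sum.distrib inner_column[OF V] flip: sum_divide_distrib)
  have col: "(\<Sum>i\<in>UNIV. P i j) \<le> 1" for j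
  proof -
    have "(\<Sum>i\<in>UNIV. (column i V \<bullet> z j)\<^sup>2) \<le> z j \<bullet> z j"
      by (rule bessel_inequality_indexed) (simp_all add: inner_column[OF V])
    then show ?thesis
      using orthostochastic(2)[OF U W(1), of j] z1[of j]
      by (simp add: P_def sum.distrib inner_commute flip: sum_divide_distrib)
  qed
  have diag: "column i U \<bullet> (X *v column i V) \<le> (\<Sum>j\<in>UNIV. P i j * ?s $ j)" for i
  proof -
    have "column j W \<bullet> (X *v column i V) = y j \<bullet> column i V" for j
      unfolding y_def by (metis dot_lmul_matrix vector_transpose_matrix transpose_transpose)
    then have "column i U \<bullet> (X *v column i V)
        = (\<Sum>j\<in>UNIV. ?s $ j * ((column j W \<bullet> column i U) * (z j \<bullet> column i V)))"
      by (subst orthogonal_matrix_parseval[OF W(1)]) (simp add: y mult_ac)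
    also have "\<dots> \<le> (\<Sum>j\<in>UNIV. ?s $ j * P i j)"
    proof (intro sum_mono mult_left_mono s)
      fix j
      show "(column j W \<bullet> column i U) * (z j \<bullet> column i V) \<le> P i j"
        using sum_squares_bound[of "column j W \<bullet> column i U" "z j \<bullet> column i V"]
        by (simp add: P_def)
    qed
    finally show ?thesis by (simp add: mult.commute)
  qed
  have "(U ** Diag b ** transpose V) \<bullet> X = (\<Sum>i\<in>UNIV. b $ i * (column i U \<bullet> (X *v column i V)))"
    by (rule inner_conj_Diag)
  also have "\<dots> \<le> (\<Sum>i\<in>UNIV. b $ i * (\<Sum>j\<in>UNIV. P i j * ?s $ j))"
    by (intro sum_mono mult_left_mono diag b)
  also have "\<dots> = (\<Sum>i\<in>UNIV. \<Sum>j\<in>UNIV. P i j * b $ i * ?s $ j)"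
    by (simp add: sum_distrib_left mult_ac)
  also have "\<dots> \<le> (\<Sum>i\<in>UNIV. b $ i * ?s $ i)"
    by (intro substochastic_rearrangement b s P_nonneg row col)
  finally show ?thesis by (simp add: inner_vec_def mult.commute)
qed

lemma singvals_conj_Diag:
  fixes U :: "real^'n::{finite,linorder}^'n::{finite,linorder}" and V :: "real^'n::{finite,linorder}^'p"
  assumes U: "orthogonal_matrix U" and V: "transpose V ** V = mat 1" and l: "\<And>i. 0 \<le> l $ i"
    and \<pi>: "\<pi> permutes UNIV" "antimono (\<lambda>i. l $ \<pi> i)"
  shows "singvals (U ** Diag l ** transpose V) = (\<chi> i. l $ \<pi> i)"
proof -
  let ?X = "U ** Diag l ** transpose V"
  have D: "transpose (Diag l) = Diag l" "Diag l ** Diag l = Diag (\<chi> i. (l $ i)\<^sup>2)"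
    by (auto simp: vec_eq_iff Diag_matrix_mult power2_eq_square) (auto simp: Diag_def transpose_def)
  have "?X ** transpose ?X = U ** Diag l ** (transpose V ** V) ** Diag l ** transpose U"
    by (simp add: matrix_transpose_mul D(1) matrix_mul_assoc)
  also have "\<dots> = U ** (Diag l ** Diag l) ** transpose U"
    using V by (simp add: matrix_mul_assoc)
  also have "\<dots> = U ** Diag (\<chi> i. (l $ i)\<^sup>2) ** transpose U"
    by (simp only: D(2))
  finally have gram: "?X ** transpose ?X = U ** Diag (\<chi> i. (l $ i)\<^sup>2) ** transpose U" .
  have "antimono (\<lambda>i. (\<chi> i. (l $ i)\<^sup>2) $ \<pi> i)"
    using \<pi>(2) l by (simp add: antimono_def power_mono)
  then have "eigvals (?X ** transpose ?X) = (\<chi> i. (\<chi> i. (l $ i)\<^sup>2) $ \<pi> i)"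
    unfolding gram by (intro eigvals_conj_Diag U \<pi>(1))
  then show ?thesis
    using l by (simp add: singvals_def vec_eq_iff)
qed

section \<open>Reduction of a pricing problem to a vector problem\<close>

lemma abs_vec_nth: "\<bar>x\<bar> $ i = \<bar>x $ i\<bar>" for x :: "real^'n"
  by (simp add: abs_vec_def)

text \<open>
  The embedding \<open>E\<close> carries the vector problem of maximizing \<open>g\<close> over \<open>F\<close> into the pricing
  problem with equal objective values, and no feasible matrix beats all feasible
  vectors. So the optimal values agree. Existence needs a closed \<open>F\<close> and the isometry: the
  superlevel set \<open>K\<close> of \<open>g\<close> at a feasible vector is then compact.
\<close>

lemma pricing_by_vector_problem:
  fixes E :: "real^'n \<Rightarrow> 'a::real_inner" and g :: "real^'n \<Rightarrow> real"
  assumes feasible: "\<And>l. l \<in> F \<Longrightarrow> E l \<in> D"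
    and obj: "\<And>l. l \<in> F \<Longrightarrow> At \<bullet> E l = g l"
    and dom: "\<And>X. X \<in> D \<Longrightarrow> \<exists>l\<in>F. At \<bullet> X \<le> g l"
    and iso: "\<And>l. norm (E l) = norm l"
    and F: "closed F" and g: "continuous_on UNIV g" and ne: "D \<noteq> {}"
  shows "(bounded_superlevels D At \<longrightarrow> (\<exists>X. pricing_opt D At X)) \<and>
    ((\<exists>X. pricing_opt D At X) \<longleftrightarrow> (\<exists>l. is_arg_max g (\<lambda>l. l \<in> F) l)) \<and>
    (\<forall>l. is_arg_max g (\<lambda>l. l \<in> F) l \<longrightarrow> pricing_opt D At (E l))"
proof -
  have opt: "pricing_opt D At (E l)" if "is_arg_max g (\<lambda>l. l \<in> F) l" for l
    using that feasible obj dom unfolding pricing_opt_def is_arg_max_linorder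
    by (metis order_trans)
  have ex: "(\<exists>X. pricing_opt D At X) \<longleftrightarrow> (\<exists>l. is_arg_max g (\<lambda>l. l \<in> F) l)"
  proof
    assume "\<exists>X. pricing_opt D At X"
    then obtain X where X: "X \<in> D" "\<And>Y. Y \<in> D \<Longrightarrow> At \<bullet> Y \<le> At \<bullet> X"
      unfolding pricing_opt_def is_arg_max_linorder by blast
    obtain l where l: "l \<in> F" "At \<bullet> X \<le> g l"
      using dom X(1) by blast
    have "g l' \<le> g l" if "l' \<in> F" for l'
      using X(2)[OF feasible[OF that]] obj[OF that] l(2) by simp
    with l(1) show "\<exists>l. is_arg_max g (\<lambda>l. l \<in> F) l"
      unfolding is_arg_max_linorder by blast
  qed (use opt in blast)
  have "\<exists>X. pricing_opt D At X" if bdd: "bounded_superlevels D At"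
  proof -
    obtain l0 where l0: "l0 \<in> F" using dom ne by blast
    define K where "K = F \<inter> {l. g l0 \<le> g l}"
    have "closed {l. g l0 \<le> g l}"
      using g by (intro closed_Collect_le) auto
    then have "closed K" using F by (simp add: K_def closed_Int)
    moreover have "bounded K"
    proof -
      obtain r where "\<And>X. X \<in> D \<Longrightarrow> g l0 \<le> At \<bullet> X \<Longrightarrow> norm X \<le> r"
        using bdd unfolding bounded_superlevels_def bounded_iff by blast
      then have "norm l \<le> r" if "l \<in> K" for l
        using that feasible obj iso unfolding K_def by (metis IntE mem_Collect_eq)
      then show ?thesis unfolding bounded_iff by blast
    qed
    ultimately have "compact K" by (simp add: compact_eq_bounded_closed)
    moreover have "l0 \<in> K" using l0 by (simp add: K_def)
    ultimately obtain l where l: "l \<in> K" "\<And>l'. l' \<in> K \<Longrightarrow> g l' \<le> g l"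
      using continuous_attains_sup[of K g] continuous_on_subset[OF g] by blast
    have "g l' \<le> g l" if "l' \<in> F" for l'
    proof (cases "g l0 \<le> g l'")
      case True
      then show ?thesis using l(2) that by (simp add: K_def)
    next
      case False
      then show ?thesis using l(2)[OF \<open>l0 \<in> K\<close>] by linarith
    qed
    then have "is_arg_max g (\<lambda>l. l \<in> F) l"
      using l(1) by (simp add: K_def is_arg_max_linorder)
    then show ?thesis using ex by blast
  qed
  then show ?thesis using opt ex by blast
qed

text \<open>
  A feasible master problem needs at least one column from the convex hull of \<open>D\<close>.
\<close>

lemma pricing_setting_nonempty: "pricing_setting D m A bl bu At \<Longrightarrow> D \<noteq> {}"
  unfolding pricing_setting_def optimal_multipliers_def master_set_def by auto

lemma norm_conj_Diag:
  fixes U :: "real^'n^'n" and V :: "real^'n^'p"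
  assumes "orthogonal_matrix U" "transpose V ** V = mat 1"
  shows "norm (U ** Diag l ** transpose V) = norm l"
  by (simp add: norm_eq_sqrt_inner inner_conj_Diag_conj_Diag[OF assms])

section \<open>Zero patterns of sorted vectors\<close>

lemma card_support_le_if_tail_zero:
  fixes l :: "real^'n::{finite,linorder}"
  assumes "\<And>i. pos i \<in> {k+1..CARD('n)} \<Longrightarrow> l $ i = 0"
  shows "card (support l) \<le> k"
proof -
  have "pos i \<in> {1..k}" if "i \<in> support l" for i
    using assms[of i] pos_range[of i] that by (force simp: support_def)
  then have "card (support l) \<le> card {1..k}"
    using bij_betw_pos[where 'n='n]
    by (intro card_inj_on_le[of pos]) (auto simp: bij_betw_def inj_on_def)
  then show ?thesis by simp
qed

lemma tail_zero_if_card_support_le: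
  fixes l :: "real^'n::{finite,linorder}"
  assumes l: "antimono (($) l)" "\<And>i. 0 \<le> l $ i" and card: "card (support l) \<le> k" and i: "k < pos i"
  shows "l $ i = 0"
proof (rule ccontr)
  assume "l $ i \<noteq> 0"
  then have "0 < l $ i" using l(2)[of i] by simp
  then have "{j. j \<le> i} \<subseteq> support l"
    using l(1) by (force simp: support_def antimono_def)
  then have "pos i \<le> k"
    using card unfolding pos_def by (meson card_mono finite order_trans)
  then show False using i by simp
qed

text \<open>
  With \<open>p\<close> positive and \<open>q\<close> negative entries, the positions \<open>p + 1, \<dots>, n - q\<close> carry zeros.
  As \<open>p + q \<le> k\<close>, they include the \<open>n - k\<close> positions that start at \<open>s = p + 1\<close>.
\<close>

lemma sorted_zero_block:
  fixes l :: "real^'n::{finite,linorder}"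
  assumes l: "antimono (($) l)" and card: "card (support l) \<le> k" and k: "k < CARD('n)"
  obtains s where "s \<in> {1..k+1}" "\<And>i. pos i \<in> {s, s + CARD('n) - k - 1} \<Longrightarrow> l $ i = 0"
proof -
  define p where "p = card {i. 0 < l $ i}"
  define q where "q = card {i. l $ i < 0}"
  have "p + q = card ({i. 0 < l $ i} \<union> {i. l $ i < 0})"
    unfolding p_def q_def by (subst card_Un_disjoint) auto
  also have "{i. 0 < l $ i} \<union> {i. l $ i < 0} = support l"
    by (auto simp: support_def)
  finally have pq: "p + q \<le> k" using card by simp
  have mono: "l $ j \<le> l $ i" if "i \<le> j" for i j
    using l that by (simp add: antimono_def)
  have pos_p: "pos i \<le> p" if "0 < l $ i" for i
    unfolding pos_def p_def by (intro card_mono) (use mono that in \<open>auto intro: less_le_trans\<close>)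
  have neg_q: "CARD('n) < pos i + q" if "l $ i < 0" for i
  proof -
    have "{j. \<not> j < i} \<subseteq> {i. l $ i < 0}"
      using mono that by (auto simp: not_less intro: le_less_trans)
    then have "- {j. j < i} \<subseteq> {i. l $ i < 0}" by auto
    then have "card (- {j. j < i}) \<le> q"
      unfolding q_def by (intro card_mono) auto
    moreover have "card {j. j < i} < pos i"
      unfolding pos_def by (intro psubset_card_mono) auto
    ultimately show ?thesis
      using card_mono[of UNIV "{j. j < i}"] by (simp add: Compl_eq_Diff_UNIV card_Diff_subset)
  qed
  define s t where "s = p + 1" and "t = s + CARD('n) - k - 1"
  have st: "s \<in> {1..k+1}" "s \<le> t" "s \<in> {1..CARD('n)}" "t \<in> {1..CARD('n)}"
    using pq k by (auto simp: s_def t_def)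
  obtain i j :: 'n where ij: "pos i = s" "pos j = t"
    using ex_pos st by metis
  have "l $ i \<le> 0" using pos_p[of i] ij by (force simp: s_def)
  moreover have "0 \<le> l $ j" using neg_q[of j] ij pq k by (force simp: s_def t_def)
  moreover have "l $ j \<le> l $ i" using mono st ij pos_le_iff by metis
  ultimately have "l $ i = 0" "l $ j = 0" by auto
  moreover have "i' = i" if "pos i' = pos i" for i' i :: 'n
    using that by (metis order_antisym order_refl pos_le_iff)
  ultimately have "l $ i' = 0" if "pos i' \<in> {s, t}" for i'
    using that ij by (metis insertE singletonD)
  then show thesis using that[OF st(1)] t_def by simp
qed

text \<open>
  Zeros at both ends of the block force zeros in between, so at least \<open>n - k\<close> entries vanish.
\<close>

lemma card_support_le_if_zero_block:
  fixes l :: "real^'n::{finite,linorder}"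
  assumes l: "antimono (($) l)" and k: "k < CARD('n)" and s: "s \<in> {1..k+1}"
    and zero: "\<And>i. pos i \<in> {s, s + CARD('n) - k - 1} \<Longrightarrow> l $ i = 0"
  shows "card (support l) \<le> k"
proof -
  define t where "t = s + CARD('n) - k - 1"
  have st: "s \<le> t" "s \<in> {1..CARD('n)}" "t \<in> {1..CARD('n)}"
    using s k by (auto simp: t_def)
  obtain i j :: 'n where ij: "pos i = s" "pos j = t"
    using ex_pos st by metis
  have "l $ i = 0" "l $ j = 0" using zero ij by (auto simp: t_def)
  then have "l $ x = 0" if "pos x \<in> {s..t}" for x
  proof -
    have "i \<le> x" "x \<le> j" using that ij pos_le_iff[of i x] pos_le_iff[of x j] by auto
    then have "l $ x \<le> l $ i" "l $ j \<le> l $ x" using l by (auto simp: antimono_def)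
    then show ?thesis using \<open>l $ i = 0\<close> \<open>l $ j = 0\<close> by simp
  qed
  then have "support l \<subseteq> - {x. pos x \<in> {s..t}}"
    by (auto simp: support_def)
  then have "card (support l) \<le> card (- {x :: 'n. pos x \<in> {s..t}})"
    by (intro card_mono) auto
  also have "\<dots> = CARD('n) - card {s..t}"
    using st card_pos_in[of "{s..t}", where 'n='n] by (simp add: Compl_eq_Diff_UNIV card_Diff_subset)
  also have "\<dots> \<le> k" using s k by (auto simp: t_def)
  finally show ?thesis .
qed

lemma closed_antimono: "closed {l :: real^'n::{finite,linorder}. antimono (($) l)}"
  unfolding antimono_def
  by (intro closed_Collect_all closed_Collect_imp closed_Collect_le open_Collect_const continuous_intros)

lemma closed_sublevel:
  fixes f :: "real^'n \<Rightarrow> real"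
  assumes "continuous_on UNIV f"
  shows "closed {l. f l \<le> 0}"
  using assms by (intro closed_Collect_le continuous_intros)

lemma eigvals_support_le_rank:
  fixes X :: "real^'n::{finite,linorder}^'n::{finite,linorder}"
  assumes "X \<in> sym_mats"
  shows "card (support (eigvals X)) \<le> rank X"
  using spectral_decomposition[OF assms] support_le_rank_conj_Diag by metis

lemma singvals_support_le_rank:
  fixes X :: "real^'p^'n::{finite,linorder}"
  shows "card (support (singvals X)) \<le> rank X"
proof -
  obtain W where W: "orthogonal_matrix W"
    "X ** transpose X = W ** Diag (\<chi> i. (singvals X $ i)\<^sup>2) ** transpose W"
    using singvals_gram[of X] by blast
  have "support (singvals X) = support (\<chi> i. (singvals X $ i)\<^sup>2)"
    by (simp add: support_def)
  then have "card (support (singvals X)) \<le> rank (X ** transpose X)"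
    using support_le_rank_conj_Diag[OF W(1)] W(2) by simp
  then show ?thesis using rank_mul_le_left order_trans by blast
qed

lemma f_singvals_conj_Diag:
  fixes U :: "real^'n::{finite,linorder}^'n::{finite,linorder}" and V :: "real^'n::{finite,linorder}^'p"
  assumes "orthogonal_matrix U" "transpose V ** V = mat 1" "\<And>i. 0 \<le> l $ i" "symmetric_fun f"
  shows "f (singvals (U ** Diag l ** transpose V)) = f l"
proof -
  obtain \<pi> where \<pi>: "\<pi> permutes UNIV" "antimono (\<lambda>i. l $ \<pi> i)"
    using sorting_permutation by blast
  then show ?thesis
    using singvals_conj_Diag[OF assms(1-3) \<pi>] assms(4) by (simp add: symmetric_fun_def)
qed

section \<open>The feasible sets of the vector problems\<close>

definition feasible_nonneg :: "nat \<Rightarrow> (real^'n::{finite,linorder} \<Rightarrow> real) \<Rightarrow> (real^'n::{finite,linorder}) set" where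
  "feasible_nonneg k f =
     {l. (\<forall>i. 0 \<le> l $ i) \<and> (\<forall>i. pos i \<in> {k+1..CARD('n)} \<longrightarrow> l $ i = 0) \<and> f l \<le> 0}"

text \<open>
  The zero block of the sorted vector problem is expressed as a bound on the number of
  nonzero entries; \<open>opt_sorted_iff\<close> shows that this is the same.
\<close>

definition feasible_sorted :: "nat \<Rightarrow> (real^'n::{finite,linorder} \<Rightarrow> real) \<Rightarrow> (real^'n::{finite,linorder}) set" where
  "feasible_sorted k f = {l. antimono (($) l) \<and> card (support l) \<le> k \<and> f l \<le> 0}"

definition feasible_abs :: "nat \<Rightarrow> (real^'n::{finite,linorder} \<Rightarrow> real) \<Rightarrow> (real^'n::{finite,linorder}) set" where
  "feasible_abs k f = {l. (\<forall>i. pos i \<in> {k+1..CARD('n)} \<longrightarrow> \<bar>l $ i\<bar> = 0) \<and> f \<bar>l\<bar> \<le> 0}"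

definition aligned :: "real^'n \<Rightarrow> (real^'n) set" where
  "aligned \<beta> = {l. \<forall>i. 0 \<le> l $ i * \<beta> $ i}"

lemma opt_nonneg_iff: "opt_nonneg k f \<beta> = is_arg_max (\<lambda>l. l \<bullet> \<beta>) (\<lambda>l. l \<in> feasible_nonneg k f)"
  by (simp add: opt_nonneg_def feasible_nonneg_def)

lemma opt_abs_iff: "opt_abs k f \<beta> = is_arg_max (\<lambda>l. \<bar>l\<bar> \<bullet> \<bar>\<beta>\<bar>) (\<lambda>l. l \<in> feasible_abs k f)"
  by (simp add: opt_abs_def feasible_abs_def)

lemma opt_sorted_iff:
  fixes \<beta> :: "real^'n::{finite,linorder}"
  assumes "k \<le> CARD('n)"
  shows "opt_sorted k f \<beta> = is_arg_max (\<lambda>l. l \<bullet> \<beta>) (\<lambda>l. l \<in> feasible_sorted k f)"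
proof -
  have block: "(\<exists>s\<in>{1..k+1}. k < CARD('n) \<longrightarrow> (\<forall>i. pos i \<in> {s, s + CARD('n) - k - 1} \<longrightarrow> l $ i = 0))
      \<longleftrightarrow> card (support l) \<le> k" (is "?block \<longleftrightarrow> _") if l: "antimono (($) l)" for l :: "real^'n::{finite,linorder}"
  proof (cases "k < CARD('n)")
    case True
    show ?thesis
    proof
      assume ?block
      then show "card (support l) \<le> k"
        using card_support_le_if_zero_block[OF l True] True by blast
    next
      assume "card (support l) \<le> k"
      then show ?block
        using sorted_zero_block[OF l _ True] by metis
    qed
  next
    case False
    then have "card (support l) \<le> k"
      using card_mono[of UNIV "support l"] by simp
    with False show ?thesis by (auto intro!: bexI[of _ 1])
  qed
  have "(\<lambda>l. \<exists>s\<in>{1..k+1}. antimono (($) l) \<and>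
        (k < CARD('n) \<longrightarrow> (\<forall>i. pos i \<in> {s, s + CARD('n) - k - 1} \<longrightarrow> l $ i = 0)) \<and> f l \<le> 0)
      = (\<lambda>l. l \<in> feasible_sorted k f)"
    unfolding feasible_sorted_def using block by (intro ext) blast
  then show ?thesis
    unfolding opt_sorted_def by simp
qed

lemma closed_tail_zero:
  "closed {l :: real^'n::{finite,linorder}. \<forall>i. pos i \<in> {k+1..CARD('n)} \<longrightarrow> l $ i = 0}"
  by (intro closed_Collect_all closed_Collect_imp open_Collect_const closed_Collect_eq continuous_intros)

text \<open>
  A finite union of coordinate subspaces.
\<close>

lemma closed_support_card: "closed {l :: real^'n. card (support l) \<le> k}"
proof -
  have "{l :: real^'n. card (support l) \<le> k}
      = (\<Union>S\<in>{S. card S \<le> k}. {l. \<forall>i. i \<notin> S \<longrightarrow> l $ i = 0})"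
  proof (intro equalityI subsetI)
    fix l :: "real^'n"
    assume "l \<in> (\<Union>S\<in>{S. card S \<le> k}. {l. \<forall>i. i \<notin> S \<longrightarrow> l $ i = 0})"
    then obtain S where S: "card S \<le> k" "support l \<subseteq> S"
      by (auto simp: support_def)
    then show "l \<in> {l. card (support l) \<le> k}"
      using card_mono[OF finite S(2)] by simp
  next
    fix l :: "real^'n"
    assume "l \<in> {l. card (support l) \<le> k}"
    then show "l \<in> (\<Union>S\<in>{S. card S \<le> k}. {l. \<forall>i. i \<notin> S \<longrightarrow> l $ i = 0})"
      by (intro UN_I[of "support l"]) (auto simp: support_def)
  qed
  also have "closed \<dots>"
    by (intro closed_UN ballI closed_Collect_all closed_Collect_imp open_Collect_const closed_Collect_eq
        continuous_intros) auto
  finally show ?thesis .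
qed

lemma closed_feasible_nonneg:
  assumes "continuous_on UNIV f" shows "closed (feasible_nonneg k f)"
proof -
  have "closed {l :: real^'n. \<forall>i. 0 \<le> l $ i}"
    by (intro closed_Collect_all closed_Collect_le continuous_intros)
  then show ?thesis
    unfolding feasible_nonneg_def
    by (intro closed_Collect_conj closed_tail_zero closed_sublevel assms)
qed

lemma closed_feasible_sorted:
  assumes "continuous_on UNIV f" shows "closed (feasible_sorted k f)"
  unfolding feasible_sorted_def
  by (intro closed_Collect_conj closed_antimono closed_support_card closed_sublevel assms)

lemma continuous_on_abs_vec: "continuous_on UNIV (\<lambda>l :: real^'n. \<bar>l\<bar>)"
  unfolding abs_vec_def by (intro continuous_intros)

lemma closed_feasible_abs_aligned:
  assumes "continuous_on UNIV f" shows "closed (feasible_abs k f \<inter> aligned \<beta>)"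
proof -
  have "continuous_on UNIV (\<lambda>l. f \<bar>l\<bar>)"
    using continuous_on_compose2[OF assms continuous_on_abs_vec] by simp
  then have "closed (feasible_abs k f)"
    unfolding feasible_abs_def abs_eq_0
    by (intro closed_Collect_conj closed_tail_zero closed_sublevel)
  moreover have "closed (aligned \<beta>)"
    unfolding aligned_def by (intro closed_Collect_all closed_Collect_le continuous_intros)
  ultimately show ?thesis by (rule closed_Int)
qed

section \<open>Feasible vectors and feasible matrices\<close>

lemma conj_Diag_in_D_sym:
  fixes U :: "real^'n::{finite,linorder}^'n::{finite,linorder}"
  assumes "orthogonal_matrix U" "symmetric_fun f" "card (support l) \<le> k" "f l \<le> 0"
  shows "U ** Diag l ** transpose U \<in> D_sym f k"
  using assms(3,4) rank_conj_Diag_le[of U l U] f_eigvals_conj_Diag[OF assms(1,2), of l]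
  by (simp add: D_sym_def rank_domain_def conj_Diag_sym)

lemma psd_vector_reduction:
  fixes U :: "real^'n::{finite,linorder}^'n::{finite,linorder}"
  assumes U: "orthogonal_matrix U" and b: "antimono (($) \<beta>)" and f: "symmetric_fun f"
    and At: "At = U ** Diag \<beta> ** transpose U"
  shows "l \<in> feasible_nonneg k f \<Longrightarrow> U ** Diag l ** transpose U \<in> D_psd f k"
    and "X \<in> D_psd f k \<Longrightarrow> \<exists>l\<in>feasible_nonneg k f. At \<bullet> X \<le> l \<bullet> \<beta>"
proof -
  assume "l \<in> feasible_nonneg k f"
  then have "\<forall>i. 0 \<le> l $ i" "card (support l) \<le> k" "f l \<le> 0"
    using card_support_le_if_tail_zero[of k l] by (simp_all add: feasible_nonneg_def)
  then show "U ** Diag l ** transpose U \<in> D_psd f k"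
    using rank_conj_Diag_le[of U l U] f_eigvals_conj_Diag[OF U f, of l]
    by (simp add: D_psd_def rank_domain_def conj_Diag_psd_iff[OF U])
next
  assume "X \<in> D_psd f k"
  then have X: "X \<in> psd_mats" "rank X \<le> k" "f (eigvals X) \<le> 0" and sym: "X \<in> sym_mats"
    by (auto simp: D_psd_def rank_domain_def psd_mats_def)
  obtain W where W: "orthogonal_matrix W" "X = W ** Diag (eigvals X) ** transpose W"
    "antimono (($) (eigvals X))"
    using spectral_decomposition[OF sym] .
  have nonneg: "0 \<le> eigvals X $ i" for i
    using X(1) W(1,2) conj_Diag_psd_iff by metis
  have "card (support (eigvals X)) \<le> k"
    using eigvals_support_le_rank[OF sym] X(2) by simp
  then have "eigvals X \<in> feasible_nonneg k f"
    using tail_zero_if_card_support_le[OF W(3) nonneg] nonneg X(3)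
    by (simp add: feasible_nonneg_def)
  then show "\<exists>l\<in>feasible_nonneg k f. At \<bullet> X \<le> l \<bullet> \<beta>"
    using trace_inequality_sym[OF U sym b] At by blast
qed

lemma rect_vector_reduction:
  fixes U :: "real^'n::{finite,linorder}^'n::{finite,linorder}" and V :: "real^'n::{finite,linorder}^'p"
  assumes U: "orthogonal_matrix U" and V: "transpose V ** V = mat 1"
    and b: "antimono (($) \<beta>)" "\<And>i. 0 \<le> \<beta> $ i" and f: "symmetric_fun f"
    and Bt: "Bt = U ** Diag \<beta> ** transpose V"
  shows "l \<in> feasible_nonneg k f \<Longrightarrow> U ** Diag l ** transpose V \<in> D_rect f k"
    and "X \<in> D_rect f k \<Longrightarrow> \<exists>l\<in>feasible_nonneg k f. Bt \<bullet> X \<le> l \<bullet> \<beta>"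
proof -
  assume "l \<in> feasible_nonneg k f"
  then have "\<And>i. 0 \<le> l $ i" "card (support l) \<le> k" "f l \<le> 0"
    using card_support_le_if_tail_zero[of k l] by (simp_all add: feasible_nonneg_def)
  then show "U ** Diag l ** transpose V \<in> D_rect f k"
    using rank_conj_Diag_le[of U l V] f_singvals_conj_Diag[OF U V _ f, of l]
    by (simp add: D_rect_def rank_domain_def)
next
  assume "X \<in> D_rect f k"
  then have X: "rank X \<le> k" "f (singvals X) \<le> 0"
    by (auto simp: D_rect_def rank_domain_def)
  obtain W where "orthogonal_matrix W"
    "X ** transpose X = W ** Diag (\<chi> i. (singvals X $ i)\<^sup>2) ** transpose W"
    and s: "antimono (($) (singvals X))" "\<And>i. 0 \<le> singvals X $ i"
    using singvals_gram[of X] by blast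
  have "card (support (singvals X)) \<le> k"
    using singvals_support_le_rank[of X] X(1) by simp
  then have "singvals X \<in> feasible_nonneg k f"
    using tail_zero_if_card_support_le[OF s] s X(2) by (simp add: feasible_nonneg_def)
  then show "\<exists>l\<in>feasible_nonneg k f. Bt \<bullet> X \<le> l \<bullet> \<beta>"
    using trace_inequality_rect[OF U V b] Bt by blast
qed

lemma sym_vector_reduction:
  fixes U :: "real^'n::{finite,linorder}^'n::{finite,linorder}"
  assumes U: "orthogonal_matrix U" and b: "antimono (($) \<beta>)"
    and At: "At = U ** Diag \<beta> ** transpose U"
    and X: "X \<in> D_sym f k"
  shows "\<exists>l\<in>feasible_sorted k f. At \<bullet> X \<le> l \<bullet> \<beta>"
proof -
  have X': "X \<in> sym_mats" "rank X \<le> k" "f (eigvals X) \<le> 0"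
    using X by (auto simp: D_sym_def rank_domain_def)
  obtain W where "orthogonal_matrix W" "X = W ** Diag (eigvals X) ** transpose W"
    and anti: "antimono (($) (eigvals X))"
    using spectral_decomposition[OF X'(1)] .
  have "eigvals X \<in> feasible_sorted k f"
    using eigvals_support_le_rank[OF X'(1)] X'(2,3) anti by (simp add: feasible_sorted_def)
  then show ?thesis
    using trace_inequality_sym[OF U X'(1) b] At by blast
qed

definition align :: "real^'n \<Rightarrow> real^'n \<Rightarrow> real^'n" where
  "align \<beta> l = (\<chi> i. if 0 \<le> \<beta> $ i then \<bar>l $ i\<bar> else - \<bar>l $ i\<bar>)"

lemma align:
  shows "\<bar>align \<beta> l\<bar> = \<bar>l\<bar>" and "align \<beta> l \<in> aligned \<beta>"
    and "l \<in> feasible_abs k f \<Longrightarrow> align \<beta> l \<in> feasible_abs k f"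
proof -
  show abs: "\<bar>align \<beta> l\<bar> = \<bar>l\<bar>"
    by (simp add: vec_eq_iff abs_vec_nth align_def)
  show "align \<beta> l \<in> aligned \<beta>"
    by (auto simp: aligned_def align_def mult_nonneg_nonpos)
  show "align \<beta> l \<in> feasible_abs k f" if "l \<in> feasible_abs k f"
    using that abs by (simp add: feasible_abs_def align_def)
qed

lemma inner_aligned: "l \<in> aligned \<beta> \<Longrightarrow> l \<bullet> \<beta> = \<bar>l\<bar> \<bullet> \<bar>\<beta>\<bar>"
  by (simp add: aligned_def inner_vec_def abs_vec_nth flip: abs_mult)

text \<open>
  Flipping signs changes neither feasibility nor the objective, so every feasible vector
  has an aligned one of equal value.
\<close>

lemma arg_max_aligned_iff:
  "is_arg_max (\<lambda>l. \<bar>l\<bar> \<bullet> \<bar>\<beta>\<bar>) (\<lambda>l. l \<in> feasible_abs k f \<inter> aligned \<beta>) l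
    \<longleftrightarrow> opt_abs k f \<beta> l \<and> l \<in> aligned \<beta>"
proof -
  have "(\<forall>l'\<in>feasible_abs k f \<inter> aligned \<beta>. \<bar>l'\<bar> \<bullet> \<bar>\<beta>\<bar> \<le> c) \<longleftrightarrow> (\<forall>l'\<in>feasible_abs k f. \<bar>l'\<bar> \<bullet> \<bar>\<beta>\<bar> \<le> c)" for c
    using align(1,2)[of \<beta>] align(3)[where \<beta> = \<beta>] by (metis IntE IntI)
  then show ?thesis
    unfolding opt_abs_iff is_arg_max_linorder by blast
qed

text \<open>
  The dominating vector has the absolute eigenvalues of \<open>X\<close> in nonincreasing order, with
  the signs of \<open>\<beta>\<close>. Its entries are eigenvalues of \<open>X\<close> only up to sign, which is where the
  sign-invariance of \<open>f\<close> enters.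
\<close>

lemma abs_vector_reduction:
  fixes U :: "real^'n::{finite,linorder}^'n::{finite,linorder}"
  assumes U: "orthogonal_matrix U" and b: "antimono (\<lambda>i. \<bar>\<beta> $ i\<bar>)" and f: "symmetric_fun f"
    "sign_invariant f" and At: "At = U ** Diag \<beta> ** transpose U"
  shows "l \<in> feasible_abs k f \<Longrightarrow> U ** Diag l ** transpose U \<in> D_sym f k"
    and "X \<in> D_sym f k \<Longrightarrow> \<exists>l\<in>feasible_abs k f \<inter> aligned \<beta>. At \<bullet> X \<le> \<bar>l\<bar> \<bullet> \<bar>\<beta>\<bar>"
proof -
  assume "l \<in> feasible_abs k f"
  then have "card (support l) \<le> k" "f l \<le> 0"
    using card_support_le_if_tail_zero[of k l] f(2) by (auto simp: feasible_abs_def sign_invariant_def)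
  then show "U ** Diag l ** transpose U \<in> D_sym f k"
    using U f(1) by (intro conj_Diag_in_D_sym)
next
  assume "X \<in> D_sym f k"
  then have X: "X \<in> sym_mats" "rank X \<le> k" "f (eigvals X) \<le> 0"
    by (auto simp: D_sym_def rank_domain_def)
  obtain \<pi> where \<pi>: "\<pi> permutes UNIV" "antimono (\<lambda>i. \<bar>eigvals X\<bar> $ \<pi> i)"
    using sorting_permutation by blast
  define l where "l = (\<chi> i. \<bar>eigvals X $ \<pi> i\<bar>)"
  have l: "antimono (($) l)" "0 \<le> l $ i" for i
    using \<pi>(2) by (simp_all add: l_def abs_vec_nth antimono_def)
  have abs_l: "\<bar>l\<bar> = l" by (simp add: vec_eq_iff abs_vec_nth l_def)
  have "support l = \<pi> -` support (eigvals X)"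
    by (auto simp: support_def l_def)
  then have "card (support l) = card (support (eigvals X))"
    using card_vimage_inj[OF permutes_inj[OF \<pi>(1)]] permutes_surj[OF \<pi>(1)] by simp
  then have "card (support l) \<le> k"
    using eigvals_support_le_rank[OF X(1)] X(2) by simp
  then have tail: "l $ i = 0" if "k < pos i" for i
    using tail_zero_if_card_support_le[OF l] that by blast
  have "f l = f \<bar>eigvals X\<bar>"
  proof -
    have "l = (\<chi> i. \<bar>eigvals X\<bar> $ \<pi> i)"
      by (simp add: l_def abs_vec_nth)
    then show ?thesis
      using f(1) \<pi>(1) by (simp add: symmetric_fun_def)
  qed
  also have "\<dots> = f (eigvals X)"
    using f(2) by (simp add: sign_invariant_def)
  finally have "l \<in> feasible_abs k f"
    using tail X(3) abs_l by (simp add: feasible_abs_def)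
  then have "align \<beta> l \<in> feasible_abs k f \<inter> aligned \<beta>"
    using align by blast
  moreover have "At \<bullet> X \<le> \<bar>align \<beta> l\<bar> \<bullet> \<bar>\<beta>\<bar>"
    using trace_inequality_sym_abs[OF U X(1) b \<pi>(1)] \<pi>(2) At
    by (simp add: align(1) inner_vec_def abs_vec_nth l_def mult.commute)
  ultimately show "\<exists>l\<in>feasible_abs k f \<inter> aligned \<beta>. At \<bullet> X \<le> \<bar>l\<bar> \<bullet> \<bar>\<beta>\<bar>" by blast
qed

section \<open>Solution of the four pricing problems\<close>

lemma psd_pricing_solution:
  fixes U :: "real^'n::{finite,linorder}^'n::{finite,linorder}"
  assumes f: "continuous_on UNIV f" "symmetric_fun f" and ne: "D_psd f k \<noteq> {}"
    and U: "orthogonal_matrix U" and At: "At = U ** Diag \<beta> ** transpose U" and b: "antimono (($) \<beta>)"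
  shows "(bounded_superlevels (D_psd f k) At \<longrightarrow> (\<exists>X. pricing_opt (D_psd f k) At X)) \<and>
    ((\<exists>X. pricing_opt (D_psd f k) At X) \<longleftrightarrow> (\<exists>l. opt_nonneg k f \<beta> l)) \<and>
    (\<forall>l. opt_nonneg k f \<beta> l \<longrightarrow> pricing_opt (D_psd f k) At (U ** Diag l ** transpose U))"
proof -
  have UU: "transpose U ** U = mat 1" using U by (simp add: orthogonal_matrix)
  show ?thesis
    unfolding opt_nonneg_iff
  proof (rule pricing_by_vector_problem)
    show "At \<bullet> (U ** Diag l ** transpose U) = l \<bullet> \<beta>" for l
      unfolding At by (rule inner_conj_Diag_conj_Diag[OF U UU])
    show "norm (U ** Diag l ** transpose U) = norm l" for l
      by (rule norm_conj_Diag[OF U UU])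
    show "continuous_on UNIV (\<lambda>l. l \<bullet> \<beta>)"
      by (intro continuous_intros)
  qed (erule psd_vector_reduction[OF U b f(2) At] | rule closed_feasible_nonneg[OF f(1)] ne)+
qed

lemma rect_pricing_solution:
  fixes U :: "real^'n::{finite,linorder}^'n::{finite,linorder}" and V :: "real^'n::{finite,linorder}^'p"
  assumes f: "continuous_on UNIV f" "symmetric_fun f" and ne: "(D_rect f k :: (real^'p^'n::{finite,linorder}) set) \<noteq> {}"
    and U: "orthogonal_matrix U" and V: "transpose V ** V = mat 1"
    and Bt: "Bt = U ** Diag \<beta> ** transpose V" and b: "\<forall>i. 0 \<le> \<beta> $ i" "antimono (($) \<beta>)"
  shows "(bounded_superlevels (D_rect f k) Bt \<longrightarrow> (\<exists>X. pricing_opt (D_rect f k) Bt X)) \<and>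
    ((\<exists>X. pricing_opt (D_rect f k) Bt X) \<longleftrightarrow> (\<exists>l. opt_nonneg k f \<beta> l)) \<and>
    (\<forall>l. opt_nonneg k f \<beta> l \<longrightarrow> pricing_opt (D_rect f k) Bt (U ** Diag l ** transpose V))"
  unfolding opt_nonneg_iff
proof (rule pricing_by_vector_problem)
  show "Bt \<bullet> (U ** Diag l ** transpose V) = l \<bullet> \<beta>" for l
    unfolding Bt by (rule inner_conj_Diag_conj_Diag[OF U V])
  show "norm (U ** Diag l ** transpose V) = norm l" for l
    by (rule norm_conj_Diag[OF U V])
  show "continuous_on UNIV (\<lambda>l. l \<bullet> \<beta>)"
    by (intro continuous_intros)
qed (erule rect_vector_reduction[OF U V b(2) b(1)[rule_format] f(2) Bt]
    | rule closed_feasible_nonneg[OF f(1)] ne)+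

lemma sym_pricing_solution:
  fixes U :: "real^'n::{finite,linorder}^'n::{finite,linorder}"
  assumes f: "continuous_on UNIV f" "symmetric_fun f" and k: "k \<le> CARD('n)" and ne: "D_sym f k \<noteq> {}"
    and U: "orthogonal_matrix U" and At: "At = U ** Diag \<beta> ** transpose U" and b: "antimono (($) \<beta>)"
  shows "(bounded_superlevels (D_sym f k) At \<longrightarrow> (\<exists>X. pricing_opt (D_sym f k) At X)) \<and>
    ((\<exists>X. pricing_opt (D_sym f k) At X) \<longleftrightarrow> (\<exists>l. opt_sorted k f \<beta> l)) \<and>
    (\<forall>l. opt_sorted k f \<beta> l \<longrightarrow> pricing_opt (D_sym f k) At (U ** Diag l ** transpose U))"
proof -
  have UU: "transpose U ** U = mat 1" using U by (simp add: orthogonal_matrix)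
  show ?thesis
    unfolding opt_sorted_iff[OF k]
  proof (rule pricing_by_vector_problem)
    show "U ** Diag l ** transpose U \<in> D_sym f k" if "l \<in> feasible_sorted k f" for l
      using that by (intro conj_Diag_in_D_sym U f(2)) (auto simp: feasible_sorted_def)
    show "At \<bullet> (U ** Diag l ** transpose U) = l \<bullet> \<beta>" for l
      unfolding At by (rule inner_conj_Diag_conj_Diag[OF U UU])
    show "norm (U ** Diag l ** transpose U) = norm l" for l
      by (rule norm_conj_Diag[OF U UU])
    show "continuous_on UNIV (\<lambda>l. l \<bullet> \<beta>)"
      by (intro continuous_intros)
  qed (erule sym_vector_reduction[OF U b At] | rule closed_feasible_sorted[OF f(1)] ne)+
qed

text \<open>
  For \<open>l\<close> with the signs of \<open>\<beta>\<close>, the matrix objective is \<open>\<bar>l\<bar> \<bullet> \<bar>\<beta>\<bar>\<close>; for other signs it can be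
  smaller. So the reduction runs over the aligned feasible vectors.
\<close>

lemma sign_invariant_pricing_solution:
  fixes U :: "real^'n::{finite,linorder}^'n::{finite,linorder}"
  assumes f: "continuous_on UNIV f" "symmetric_fun f" and ne: "D_sym f k \<noteq> {}"
    and sign: "sign_invariant f"
    and U: "orthogonal_matrix U" and At: "At = U ** Diag \<beta> ** transpose U"
    and b: "antimono (\<lambda>i. \<bar>\<beta> $ i\<bar>)"
  shows "(bounded_superlevels (D_sym f k) At \<longrightarrow> (\<exists>X. pricing_opt (D_sym f k) At X)) \<and>
    ((\<exists>X. pricing_opt (D_sym f k) At X) \<longleftrightarrow>
       (\<exists>l. opt_abs k f \<beta> l \<and> pricing_opt (D_sym f k) At (U ** Diag l ** transpose U))) \<and>
    ((\<exists>X. pricing_opt (D_sym f k) At X) \<longleftrightarrow> (\<exists>l. opt_abs k f \<beta> l)) \<and>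
    (\<forall>l. opt_abs k f \<beta> l \<and> (\<forall>i. 0 \<le> l $ i * \<beta> $ i) \<longrightarrow>
       pricing_opt (D_sym f k) At (U ** Diag l ** transpose U))"
proof -
  have UU: "transpose U ** U = mat 1" using U by (simp add: orthogonal_matrix)
  have "(bounded_superlevels (D_sym f k) At \<longrightarrow> (\<exists>X. pricing_opt (D_sym f k) At X)) \<and>
    ((\<exists>X. pricing_opt (D_sym f k) At X) \<longleftrightarrow>
       (\<exists>l. is_arg_max (\<lambda>l. \<bar>l\<bar> \<bullet> \<bar>\<beta>\<bar>) (\<lambda>l. l \<in> feasible_abs k f \<inter> aligned \<beta>) l)) \<and>
    (\<forall>l. is_arg_max (\<lambda>l. \<bar>l\<bar> \<bullet> \<bar>\<beta>\<bar>) (\<lambda>l. l \<in> feasible_abs k f \<inter> aligned \<beta>) l \<longrightarrow>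
       pricing_opt (D_sym f k) At (U ** Diag l ** transpose U))"
  proof (rule pricing_by_vector_problem)
    show "U ** Diag l ** transpose U \<in> D_sym f k" if "l \<in> feasible_abs k f \<inter> aligned \<beta>" for l
      using that by (intro abs_vector_reduction(1)[OF U b f(2) sign At]) simp
    show "At \<bullet> (U ** Diag l ** transpose U) = \<bar>l\<bar> \<bullet> \<bar>\<beta>\<bar>"
      if "l \<in> feasible_abs k f \<inter> aligned \<beta>" for l
      using that inner_aligned[of l \<beta>] unfolding At inner_conj_Diag_conj_Diag[OF U UU] by simp
    show "norm (U ** Diag l ** transpose U) = norm l" for l
      by (rule norm_conj_Diag[OF U UU])
    show "continuous_on UNIV (\<lambda>l. \<bar>l\<bar> \<bullet> \<bar>\<beta>\<bar>)"
      by (intro continuous_intros continuous_on_abs_vec)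
  qed (erule abs_vector_reduction(2)[OF U b f(2) sign At]
      | rule closed_feasible_abs_aligned[OF f(1)] ne)+
  then have bdd: "bounded_superlevels (D_sym f k) At \<Longrightarrow> \<exists>X. pricing_opt (D_sym f k) At X"
    and ex: "(\<exists>X. pricing_opt (D_sym f k) At X) \<longleftrightarrow> (\<exists>l. opt_abs k f \<beta> l \<and> l \<in> aligned \<beta>)"
    and opt: "\<And>l. opt_abs k f \<beta> l \<Longrightarrow> l \<in> aligned \<beta> \<Longrightarrow>
      pricing_opt (D_sym f k) At (U ** Diag l ** transpose U)"
    unfolding arg_max_aligned_iff by blast+
  have "opt_abs k f \<beta> (align \<beta> l)" if "opt_abs k f \<beta> l" for l
    using that align(1)[of \<beta> l] align(3)[where \<beta> = \<beta>] unfolding opt_abs_iff is_arg_max_linorder by simp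
  then have "(\<exists>l. opt_abs k f \<beta> l) \<longleftrightarrow> (\<exists>l. opt_abs k f \<beta> l \<and> l \<in> aligned \<beta>)"
    using align(2) by blast
  moreover have "pricing_opt (D_sym f k) At (U ** Diag l ** transpose U)"
    if "opt_abs k f \<beta> l" "\<forall>i. 0 \<le> l $ i * \<beta> $ i" for l
    using opt that by (simp add: aligned_def)
  ultimately show ?thesis using bdd ex opt by blast
qed

theorem theorem10:
  fixes f :: "real^'n::{finite,linorder} \<Rightarrow> real"
    and k m :: nat
    and bl bu :: "nat \<Rightarrow> ereal"
    and A :: "nat \<Rightarrow> real^'n::{finite,linorder}^'n::{finite,linorder}"
    and At U :: "real^'n::{finite,linorder}^'n::{finite,linorder}"
    and B :: "nat \<Rightarrow> real^'p::finite^'n::{finite,linorder}"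
    and Bt :: "real^'p::finite^'n::{finite,linorder}"
    and V :: "real^'n::{finite,linorder}^'p::finite"
    and \<beta> :: "real^'n::{finite,linorder}"
  assumes "1 \<le> k" and "k \<le> CARD('n)" and "CARD('n) \<le> CARD('p)"
    and "continuous_on UNIV f" and "convex_on UNIV f" and "symmetric_fun f"
  shows
    "((\<forall>i\<le>m. A i \<in> sym_mats) \<and> pricing_setting (D_psd f k) m A bl bu At \<and>
      orthogonal_matrix U \<and> At = U ** Diag \<beta> ** transpose U \<and> antimono (($) \<beta>) \<longrightarrow>
        (bounded_superlevels (D_psd f k) At \<longrightarrow> (\<exists>X. pricing_opt (D_psd f k) At X)) \<and>
        ((\<exists>X. pricing_opt (D_psd f k) At X) \<longleftrightarrow> (\<exists>l. opt_nonneg k f \<beta> l)) \<and>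
        (\<forall>l. opt_nonneg k f \<beta> l \<longrightarrow> pricing_opt (D_psd f k) At (U ** Diag l ** transpose U)))
     \<and>
     (sign_invariant f \<and> pricing_setting (D_rect f k) m B bl bu Bt \<and>
      orthogonal_matrix U \<and> transpose V ** V = mat 1 \<and>
      Bt = U ** Diag \<beta> ** transpose V \<and> (\<forall>i. 0 \<le> \<beta> $ i) \<and> antimono (($) \<beta>) \<longrightarrow>
        (bounded_superlevels (D_rect f k) Bt \<longrightarrow> (\<exists>X. pricing_opt (D_rect f k) Bt X)) \<and>
        ((\<exists>X. pricing_opt (D_rect f k) Bt X) \<longleftrightarrow> (\<exists>l. opt_nonneg k f \<beta> l)) \<and>
        (\<forall>l. opt_nonneg k f \<beta> l \<longrightarrow> pricing_opt (D_rect f k) Bt (U ** Diag l ** transpose V)))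
     \<and>
     ((\<forall>i\<le>m. A i \<in> sym_mats) \<and> pricing_setting (D_sym f k) m A bl bu At \<and>
      orthogonal_matrix U \<and> At = U ** Diag \<beta> ** transpose U \<and> antimono (($) \<beta>) \<longrightarrow>
        (bounded_superlevels (D_sym f k) At \<longrightarrow> (\<exists>X. pricing_opt (D_sym f k) At X)) \<and>
        ((\<exists>X. pricing_opt (D_sym f k) At X) \<longleftrightarrow> (\<exists>l. opt_sorted k f \<beta> l)) \<and>
        (\<forall>l. opt_sorted k f \<beta> l \<longrightarrow> pricing_opt (D_sym f k) At (U ** Diag l ** transpose U)))
     \<and>
     (sign_invariant f \<and> (\<forall>i\<le>m. A i \<in> sym_mats) \<and> pricing_setting (D_sym f k) m A bl bu At \<and>
      orthogonal_matrix U \<and> At = U ** Diag \<beta> ** transpose U \<and> antimono (\<lambda>i. \<bar>\<beta> $ i\<bar>) \<longrightarrow>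
        (bounded_superlevels (D_sym f k) At \<longrightarrow> (\<exists>X. pricing_opt (D_sym f k) At X)) \<and>
        ((\<exists>X. pricing_opt (D_sym f k) At X) \<longleftrightarrow>
           (\<exists>l. opt_abs k f \<beta> l \<and> pricing_opt (D_sym f k) At (U ** Diag l ** transpose U))) \<and>
        ((\<exists>X. pricing_opt (D_sym f k) At X) \<longleftrightarrow> (\<exists>l. opt_abs k f \<beta> l)) \<and>
        (\<forall>l. opt_abs k f \<beta> l \<and> (\<forall>i. 0 \<le> l $ i * \<beta> $ i) \<longrightarrow>
           pricing_opt (D_sym f k) At (U ** Diag l ** transpose U)))"
proof -
  note cont = \<open>continuous_on UNIV f\<close> and symf = \<open>symmetric_fun f\<close> and kn = \<open>k \<le> CARD('n)\<close>
  note psd = psd_pricing_solution[OF cont symf pricing_setting_nonempty]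
    and rect = rect_pricing_solution[OF cont symf pricing_setting_nonempty]
    and sym = sym_pricing_solution[OF cont symf kn pricing_setting_nonempty]
    and abs = sign_invariant_pricing_solution[OF cont symf pricing_setting_nonempty]
  show ?thesis
    by (intro conjI[of "_ \<longrightarrow> _"]; rule impI; elim conjE)
      (rule psd rect sym abs; assumption)+
qed

end
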